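(* Let $X\in\mathbb{R}^{m\times N}$, $W\in\mathbb{R}^{N\times N'}$, $\lambda>0$ and $\delta>0$. Run OPTQ with the stochastic rounding operator $\mathcal{Q}_{\mathrm{stoc}}$, the infinite alphabet $\mathcal{A}^\delta$, and Hessian $H=X^\top X+\lambda I$ on every column of $W$, obtaining the quantized matrix $Q$. Then for any $p,p'>0$ and any column $w$ of $W$ with quantized version $q$, $$\|Xw-Xq\|_\infty\le\delta\sqrt{2\pi p\log N}\cdot C_\infty(X,\lambda)\quad\text{and}\quad\|w-q\|_\infty\le\delta\sqrt{2\pi p\log N}\cdot\frac{C_\infty(X,\lambda)}{\sqrt{\lambda}}$$ with probability at least $1-\frac{\sqrt2\,(m+N)}{N^p}$. Moreover, with probability at least $1-\frac{\sqrt2\,(m+N)}{N^p{N'}^{p'-1}}$, $$\max_{i,j}|(XW-XQ)_{ij}|\le\delta\sqrt{2\pi(p\log N+p'\log N')}\cdot C_\infty(X,\lambda)$$ and $$\max_{i,j}|(W-Q)_{ij}|\le\delta\sqrt{2\pi(p\log N+p'\log N')}\cdot\frac{C_\infty(X,\lambda)}{\sqrt{\lambda}},$$ where $$C_\infty(X,\lambda)^2=\max\left\{\max_{j\le N-m}\frac{\lambda\|X_j\|_2^2}{(\sigma^{(j)}_{\min})^2+\lambda},\ \max_{j>N-m}\|X_j\|_2^2\right\}+\lambda,$$ $j$ ranges over $\{1,\dots,N\}$, and $\sigma^{(j)}_{\min}$ denotes the smallest singular value of $X_{\ge j+1}$.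
   Context: Notation: $X_j$ is the $j$-th column of $X$ and $X_{\ge j}=(X_j,\dots,X_N)$. For $j\le N-m$ the matrix $X_{\ge j+1}$ is $m\times(N-j)$ with $N-j\ge m$; its smallest singular value is the smallest of its $m$ singular values (possibly $0$). When $N\le m$ the index set $\{j\le N-m\}$ is empty and the corresponding term is omitted. Stochastic quantizer: for $\mathcal{A}^\delta=\{k\delta:k\in\mathbb{Z}\}$, $\mathcal{Q}_{\mathrm{stoc}}(z)$ equals $\lfloor z/\delta\rfloor\delta$ with probability $1-\frac z\delta+\lfloor\frac z\delta\rfloor$ and $(\lfloor z/\delta\rfloor+1)\delta$ otherwise, so $\mathbb{E}[\mathcal{Q}_{\mathrm{stoc}}(z)]=z$; each call uses fresh randomness independent of the past. OPTQ with an invertible symmetric positive definite Hessian $H\in\mathbb{R}^{N\times N}$ and stochastic rounding, applied to $w\in\mathbb{R}^N$: let $H^{-1}=LL^\top$ be the Cholesky decomposition ($L$ lower triangular). Set $w^{(0)}=w$. For $t=1,\dots,N$: set $q_t=\mathcal{Q}_{\mathrm{stoc}}(w^{(t-1)}_t)$ and $w^{(t)}_{\ge t+1}=w^{(t-1)}_{\ge t+1}+(q_t-w^{(t-1)}_t)\,L_{\ge t+1,t}/L_{tt}$, where $v_{\ge j}=(v_j,\dots,v_N)^\top$ and $L_{\ge t+1,t}$ is the part of the $t$-th column of $L$ below the diagonal. The output is $q=(q_1,\dots,q_N)^\top$. For a matrix $W$ the procedure is applied to each column $w$, and the outputs $q$ are the columns of $Q$. *)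

theory Defs
  imports
    "HOL-Probability.Probability"
    "Jordan_Normal_Form.Gauss_Jordan_Elimination"
    "Jordan_Normal_Form.Char_Poly"
begin

no_notation Finite_Cartesian_Product.vec_nth (infixl \<open>$\<close> 90)

text \<open>All indices are 0-based: index \<open>j\<close> below is the mathematical index \<open>j + 1\<close>.\<close>

definition l2_norm :: "real vec \<Rightarrow> real" where
  "l2_norm v = sqrt (\<Sum>i<dim_vec v. (v $ i)\<^sup>2)"

definition linf_norm :: "real vec \<Rightarrow> real" where
  "linf_norm v = Max ((\<lambda>i. \<bar>v $ i\<bar>) ` {..<dim_vec v})"

definition max_abs_entry :: "real mat \<Rightarrow> real" where
  "max_abs_entry A = Max ((\<lambda>(i, j). \<bar>A $$ (i, j)\<bar>) ` ({..<dim_row A} \<times> {..<dim_col A}))"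

definition drop_cols :: "nat \<Rightarrow> real mat \<Rightarrow> real mat" where
  "drop_cols j A = mat (dim_row A) (dim_col A - j) (\<lambda>(i, k). A $$ (i, j + k))"

text \<open>The singular values of an \<open>m \<times> n\<close> matrix are the \<open>min m n\<close> square roots of the
  eigenvalues of the smaller of its two Gram matrices; 0 is among them iff the rank is
  below \<open>min m n\<close>.\<close>

definition singular_values :: "real mat \<Rightarrow> real set" where
  "singular_values A =
     sqrt ` {k. eigenvalue (if dim_row A \<le> dim_col A
                            then A * transpose_mat A else transpose_mat A * A) k}"

definition sigma_min :: "real mat \<Rightarrow> real" where
  "sigma_min A = Min (singular_values A)"

text \<open>The condition \<open>j + m < N\<close> is \<open>j + 1 \<le> N - m\<close> without truncated subtraction, and
  \<open>drop_cols (Suc j) X\<close> consists of the columns strictly to the right of column \<open>j\<close>.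
  The maximum of the two maxima is taken over the union, so that an empty range
  (the case \<open>N \<le> m\<close>) contributes nothing.\<close>

definition C_inf :: "real mat \<Rightarrow> real \<Rightarrow> real" where
  "C_inf X lam = (let m = dim_row X; N = dim_col X in
     sqrt (Max
       ({lam * (l2_norm (col X j))\<^sup>2 / ((sigma_min (drop_cols (Suc j) X))\<^sup>2 + lam) | j.
           j < N \<and> j + m < N}
        \<union> {(l2_norm (col X j))\<^sup>2 | j. j < N \<and> N \<le> j + m}) + lam))"

definition is_cholesky :: "real mat \<Rightarrow> real mat \<Rightarrow> bool" where
  "is_cholesky A L \<longleftrightarrow>
     L \<in> carrier_mat (dim_row A) (dim_row A) \<and>
     (\<forall>i<dim_row A. \<forall>j<dim_row A. i < j \<longrightarrow> L $$ (i, j) = 0) \<and>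
     (\<forall>i<dim_row A. 0 < L $$ (i, i)) \<and>
     A = L * transpose_mat L"

text \<open>The positive diagonal makes the factor of a symmetric positive definite matrix unique.\<close>

definition cholesky :: "real mat \<Rightarrow> real mat" where
  "cholesky A = (THE L. is_cholesky A L)"

text \<open>The alphabet is \<open>{k * \<delta> | k. k \<in> \<int>}\<close>, and \<open>True\<close> is the outcome ``round down''.\<close>

definition Q_stoc :: "real \<Rightarrow> real \<Rightarrow> real pmf" where
  "Q_stoc \<delta> z =
     map_pmf (\<lambda>down. if down then of_int \<lfloor>z / \<delta>\<rfloor> * \<delta> else (of_int \<lfloor>z / \<delta>\<rfloor> + 1) * \<delta>)
       (bernoulli_pmf (1 - z / \<delta> + of_int \<lfloor>z / \<delta>\<rfloor>))"

text \<open>The state after \<open>t\<close> steps is the pair of the working vector, whose entries from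
  position \<open>t\<close> on are the current \<open>w\<^sup>(\<^sup>t\<^sup>)\<close> (earlier entries are never read again), and the
  output vector, whose first \<open>t\<close> entries have been determined.\<close>

primrec optq_state ::
  "real \<Rightarrow> real mat \<Rightarrow> real vec \<Rightarrow> nat \<Rightarrow> (real vec \<times> real vec) pmf" where
  "optq_state \<delta> L w 0 = return_pmf (w, 0\<^sub>v (dim_vec w))"
| "optq_state \<delta> L w (Suc t) =
     bind_pmf (optq_state \<delta> L w t) (\<lambda>(v, q).
     bind_pmf (Q_stoc \<delta> (v $ t)) (\<lambda>qt.
     return_pmf
       (vec (dim_vec w)
          (\<lambda>i. if t < i then v $ i + (qt - v $ t) * L $$ (i, t) / L $$ (t, t) else v $ i),
        vec (dim_vec w) (\<lambda>i. if i = t then qt else q $ i))))"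

definition optq_vec :: "real \<Rightarrow> real mat \<Rightarrow> real vec \<Rightarrow> real vec pmf" where
  "optq_vec \<delta> H w =
     map_pmf snd (optq_state \<delta> (cholesky (the (mat_inverse H))) w (dim_vec w))"

text \<open>The columns are quantized with independent randomness.\<close>

definition optq :: "real \<Rightarrow> real mat \<Rightarrow> real mat \<Rightarrow> real mat pmf" where
  "optq \<delta> H W =
     map_pmf (\<lambda>f. mat (dim_row W) (dim_col W) (\<lambda>(i, k). f k $ i))
       (Pi_pmf {..<dim_col W} (0\<^sub>v (dim_row W)) (\<lambda>k. optq_vec \<delta> H (col W k)))"

definition hessian :: "real mat \<Rightarrow> real \<Rightarrow> real mat" where
  "hessian X lam = transpose_mat X * X + lam \<cdot>\<^sub>m 1\<^sub>m (dim_col X)"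

end

theory Submission
  imports Defs
begin

text \<open>Let \<open>L\<close> be the Cholesky factor of \<open>H\<^sup>-\<^sup>1\<close> and \<open>e\<^sub>t\<close> the rounding error of step \<open>t\<close>, which
  given the past has mean zero and lies in an interval of length \<open>\<delta>\<close>. Since an OPTQ step adds
  a multiple of a column of \<open>L\<close>, we have \<open>q - w = (\<Sum>t. e\<^sub>t L\<^sub>t / L\<^sub>t\<^sub>t)\<close>. Applying Hoeffding's lemma
  step by step, \<open>u \<bullet> (q - w)\<close> is sub-Gaussian with variance proxy
  \<open>\<delta>\<^sup>2 / 4 * (\<Sum>t. (u \<bullet> L\<^sub>t)\<^sup>2 / L\<^sub>t\<^sub>t\<^sup>2)\<close>. Let \<open>Y\<close> be \<open>X\<close> stacked on \<open>\<surd>lam I\<close>. Then \<open>Y L\<close> has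
  orthonormal columns, so its rows have norm at most 1, and for \<open>u\<close> a row of \<open>Y\<close> the sum is at
  most the maximum of \<open>1 / L\<^sub>t\<^sub>t\<^sup>2\<close>. Finally \<open>1 / L\<^sub>t\<^sub>t\<^sup>2\<close> is the minimum over \<open>b\<close> of
  \<open>\<parallel>X\<^sub>t - X\<^sub>>\<^sub>t b\<parallel>\<^sup>2 + lam (1 + \<parallel>b\<parallel>\<^sup>2)\<close>: testing \<open>b = 0\<close>, or the ridge regression solution if there
  are at least \<open>m\<close> columns to the right of \<open>t\<close>, bounds it by \<open>C_inf\<^sup>2\<close>.\<close>

no_notation inner (infixl "\<bullet>" 70)

subsection \<open>Quadratic forms\<close>

lemma scalar_prod_sum: "v \<bullet> w = (\<Sum>i<dim_vec w. v $ i * w $ i)"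
  unfolding scalar_prod_def by (simp add: atLeast0LessThan)

lemma mult_mat_vec_sum:
  assumes "A \<in> carrier_mat m n" "v \<in> carrier_vec n" "i < m"
  shows "(A *\<^sub>v v) $ i = (\<Sum>j<n. A $$ (i, j) * v $ j)"
  using assms by (simp add: scalar_prod_sum)

lemma quadratic_form_sum:
  fixes A :: "real mat"
  assumes "A \<in> carrier_mat n n" "v \<in> carrier_vec n"
  shows "v \<bullet> (A *\<^sub>v v) = (\<Sum>i<n. \<Sum>j<n. v $ i * A $$ (i, j) * v $ j)"
proof -
  have "v \<bullet> (A *\<^sub>v v) = (\<Sum>i<n. v $ i * (A *\<^sub>v v) $ i)"
    using assms by (simp add: scalar_prod_sum)
  also have "\<dots> = (\<Sum>i<n. \<Sum>j<n. v $ i * A $$ (i, j) * v $ j)"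
    using assms by (intro sum.cong refl) (subst mult_mat_vec_sum[OF assms], auto simp: sum_distrib_left mult.assoc)
  finally show ?thesis .
qed

lemma scalar_prod_self_nonneg: "0 \<le> v \<bullet> v" for v :: "real vec"
  unfolding scalar_prod_sum by (intro sum_nonneg) auto

lemma scalar_prod_self_eq_0:
  fixes v :: "real vec"
  assumes "v \<in> carrier_vec n"
  shows "v \<bullet> v = 0 \<longleftrightarrow> v = 0\<^sub>v n"
proof
  assume "v \<bullet> v = 0"
  then have "\<forall>i<n. v $ i = 0"
    using assms unfolding scalar_prod_sum by (subst (asm) sum_nonneg_eq_0_iff) auto
  then show "v = 0\<^sub>v n" using assms by (intro eq_vecI) auto
qed (use assms in auto)

lemma square_nth_le_scalar_prod_self:
  fixes v :: "real vec"
  assumes "i < dim_vec v"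
  shows "(v $ i)\<^sup>2 \<le> v \<bullet> v"
  unfolding scalar_prod_sum power2_eq_square
  using assms by (intro member_le_sum) auto

lemma l2_norm_squared: "(l2_norm v)\<^sup>2 = v \<bullet> v"
  unfolding l2_norm_def scalar_prod_sum by (simp add: sum_nonneg power2_eq_square)

lemma scalar_prod_diff_self:
  fixes v u :: "real vec"
  assumes "v \<in> carrier_vec n" "u \<in> carrier_vec n"
  shows "(v - c \<cdot>\<^sub>v u) \<bullet> (v - c \<cdot>\<^sub>v u) = v \<bullet> v - 2 * c * (u \<bullet> v) + c\<^sup>2 * (u \<bullet> u)"
  using assms
  by (simp add: minus_scalar_prod_distrib[of _ n] scalar_prod_minus_distrib[of _ n]
      comm_scalar_prod[of v n u] algebra_simps power2_eq_square)

text \<open>Each product of two coordinates is at most \<open>v \<bullet> v\<close>, so the sum of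
  the absolute entries serves as \<open>K\<close>; one is added so that \<open>K\<close> can be
  divided by even for the zero matrix.\<close>

lemma abs_quadratic_form_le:
  fixes A :: "real mat"
  assumes A: "A \<in> carrier_mat n n"
  obtains K where "0 < K" "\<And>v. v \<in> carrier_vec n \<Longrightarrow> \<bar>v \<bullet> (A *\<^sub>v v)\<bar> \<le> K * (v \<bullet> v)"
proof
  let ?S = "\<Sum>i<n. \<Sum>j<n. \<bar>A $$ (i, j)\<bar>"
  show "0 < ?S + 1"
    by (smt (verit) sum_nonneg abs_ge_zero)
  fix v :: "real vec" assume v: "v \<in> carrier_vec n"
  have "\<bar>v $ i * A $$ (i, j) * v $ j\<bar> \<le> \<bar>A $$ (i, j)\<bar> * (v \<bullet> v)" if "i < n" "j < n" for i j
  proof -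
    have "2 * (\<bar>v $ i\<bar> * \<bar>v $ j\<bar>) \<le> (v $ i)\<^sup>2 + (v $ j)\<^sup>2"
      using sum_squares_bound[of "\<bar>v $ i\<bar>" "\<bar>v $ j\<bar>"] by simp
    also have "\<dots> \<le> 2 * (v \<bullet> v)"
      using that v square_nth_le_scalar_prod_self[of i v] square_nth_le_scalar_prod_self[of j v] by auto
    finally have "\<bar>v $ i\<bar> * \<bar>v $ j\<bar> \<le> v \<bullet> v" by simp
    then have "\<bar>A $$ (i, j)\<bar> * (\<bar>v $ i\<bar> * \<bar>v $ j\<bar>) \<le> \<bar>A $$ (i, j)\<bar> * (v \<bullet> v)"
      by (rule mult_left_mono) simp
    then show ?thesis by (simp add: abs_mult mult_ac)
  qed
  then have "\<bar>v \<bullet> (A *\<^sub>v v)\<bar> \<le> (\<Sum>i<n. \<Sum>j<n. \<bar>A $$ (i, j)\<bar> * (v \<bullet> v))"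
    unfolding quadratic_form_sum[OF A v]
    by (intro order_trans[OF sum_abs] sum_mono) auto
  also have "\<dots> = ?S * (v \<bullet> v)"
    by (simp add: sum_distrib_right)
  also have "\<dots> \<le> (?S + 1) * (v \<bullet> v)"
    using scalar_prod_self_nonneg[of v] by (simp add: algebra_simps)
  finally show "\<bar>v \<bullet> (A *\<^sub>v v)\<bar> \<le> (?S + 1) * (v \<bullet> v)" .
qed

section \<open>Invertibility of coercive matrices and the smallest eigenvalue of a symmetric
  matrix\<close>

lemma det_nonzero_obtain_inverse:
  fixes A :: "'a :: field mat"
  assumes A: "A \<in> carrier_mat n n" and "det A \<noteq> 0"
  obtains B where "mat_inverse A = Some B" "B \<in> carrier_mat n n" "A * B = 1\<^sub>m n" "B * A = 1\<^sub>m n"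
proof -
  have "A \<in> Units (ring_mat TYPE('a) n ())"
    using det_non_zero_imp_unit[OF assms] .
  then obtain B where "mat_inverse A = Some B"
    using mat_inverse(1)[OF A, where b = "()"] by (cases "mat_inverse A") auto
  then show thesis using that mat_inverse(2)[OF A] by blast
qed

text \<open>At a kernel vector the form vanishes, and coercivity then forces the vector to be
  zero.\<close>

lemma coercive_det_nonzero:
  fixes A :: "real mat"
  assumes A: "A \<in> carrier_mat n n" and "0 < c"
    and ge: "\<And>v. v \<in> carrier_vec n \<Longrightarrow> c * (v \<bullet> v) \<le> v \<bullet> (A *\<^sub>v v)"
  shows "det A \<noteq> 0"
proof
  assume "det A = 0"
  then obtain v where v: "v \<in> carrier_vec n" "v \<noteq> 0\<^sub>v n" "A *\<^sub>v v = 0\<^sub>v n"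
    using det_0_iff_vec_prod_zero[OF A] by auto
  then have "c * (v \<bullet> v) \<le> 0" using ge[OF v(1)] by simp
  then have "v \<bullet> v = 0"
    using \<open>0 < c\<close> scalar_prod_self_nonneg[of v] by (simp add: mult_le_0_iff)
  then show False using v scalar_prod_self_eq_0 by blast
qed

lemma mult_add_scalar_mat_vec:
  fixes A :: "'a :: comm_ring_1 mat"
  assumes "A \<in> carrier_mat n n" "v \<in> carrier_vec n"
  shows "(A + c \<cdot>\<^sub>m 1\<^sub>m n) *\<^sub>v v = A *\<^sub>v v + c \<cdot>\<^sub>v v"
  using assms by (intro eq_vecI) (auto simp: add_scalar_prod_distrib[of _ n])

text \<open>The largest \<open>s\<close> with \<open>G - s I\<close> positive semidefinite is an eigenvalue: if \<open>M = G - s I\<close>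
  were invertible, then for \<open>M u = v\<close> and \<open>K\<close> bounding the form of \<open>M\<^sup>-\<^sup>1\<close>, positivity
  of the form of \<open>M\<close> at \<open>v - u / K\<close> would give \<open>v \<bullet> M v \<ge> (v \<bullet> v) / K\<close>.\<close>

lemma symmetric_obtain_min_eigenvalue:
  fixes G :: "real mat"
  assumes G: "G \<in> carrier_mat n n" and sym: "transpose_mat G = G" and "0 < n"
  obtains s where "eigenvalue G s" "\<And>v. v \<in> carrier_vec n \<Longrightarrow> s * (v \<bullet> v) \<le> v \<bullet> (G *\<^sub>v v)"
proof -
  define S where "S = {s. \<forall>v\<in>carrier_vec n. s * (v \<bullet> v) \<le> v \<bullet> (G *\<^sub>v v)}"
  obtain K where K: "\<And>v. v \<in> carrier_vec n \<Longrightarrow> \<bar>v \<bullet> (G *\<^sub>v v)\<bar> \<le> K * (v \<bullet> v)"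
    using abs_quadratic_form_le[OF G] by blast
  have ne: "- K \<in> S"
    unfolding S_def using K by (force simp: abs_le_iff)
  have bdd: "bdd_above S"
  proof (rule bdd_aboveI)
    fix s assume "s \<in> S"
    then have "s * (unit_vec n 0 \<bullet> unit_vec n 0) \<le> unit_vec n 0 \<bullet> (G *\<^sub>v unit_vec n 0)"
      unfolding S_def by auto
    then show "s \<le> unit_vec n 0 \<bullet> (G *\<^sub>v unit_vec n 0)"
      using \<open>0 < n\<close> by simp
  qed
  \<comment> \<open>This is the infimum of the Rayleigh quotient, written as the supremum of its
    lower bounds.\<close>
  define s where "s = Sup S"
  have sS: "s * (v \<bullet> v) \<le> v \<bullet> (G *\<^sub>v v)" if v: "v \<in> carrier_vec n" for v
  proof (cases "v \<bullet> v = 0")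
    case True
    then have "v = 0\<^sub>v n" using v scalar_prod_self_eq_0 by blast
    then show ?thesis using G by simp
  next
    case False
    then have pos: "0 < v \<bullet> v" using scalar_prod_self_nonneg[of v] by simp
    have "s \<le> (v \<bullet> (G *\<^sub>v v)) / (v \<bullet> v)"
      unfolding s_def
    proof (rule cSup_least)
      show "S \<noteq> {}" using ne by blast
    qed (use v pos in \<open>auto simp: S_def pos_le_divide_eq\<close>)
    then show ?thesis using pos by (simp add: pos_le_divide_eq)
  qed
  have "eigenvalue G s"
  proof (rule ccontr)
    assume neg: "\<not> eigenvalue G s"
    define M where "M = char_matrix G s"
    have M: "M \<in> carrier_mat n n" unfolding M_def using G by simp
    have Mv: "M *\<^sub>v v = G *\<^sub>v v - s \<cdot>\<^sub>v v" if "v \<in> carrier_vec n" for v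
      using that G unfolding M_def char_matrix_def
      by (intro eq_vecI) (auto simp: add_scalar_prod_distrib[of _ n])
    have form: "w \<bullet> (M *\<^sub>v w) = w \<bullet> (G *\<^sub>v w) - s * (w \<bullet> w)" if "w \<in> carrier_vec n" for w
      using that G by (simp add: Mv scalar_prod_minus_distrib[of _ n])
    have Msym: "(M *\<^sub>v u) \<bullet> v = u \<bullet> (M *\<^sub>v v)" if "u \<in> carrier_vec n" "v \<in> carrier_vec n" for u v
    proof -
      have "transpose_mat (- s \<cdot>\<^sub>m 1\<^sub>m n) = - s \<cdot>\<^sub>m 1\<^sub>m n"
        by (intro eq_matI) auto
      then have "transpose_mat M = M"
        using sym G unfolding M_def char_matrix_def by (simp add: transpose_add[of _ n n])
      then show ?thesis using transpose_vec_mult_scalar[OF M that(2,1)] by simp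
    qed
    from neg have "det M \<noteq> 0" unfolding M_def eigenvalue_det[OF G] .
    then obtain B where B: "B \<in> carrier_mat n n" "M * B = 1\<^sub>m n"
      using det_nonzero_obtain_inverse[OF M] by blast
    obtain K where K: "0 < K" "\<And>v. v \<in> carrier_vec n \<Longrightarrow> \<bar>v \<bullet> (B *\<^sub>v v)\<bar> \<le> K * (v \<bullet> v)"
      using abs_quadratic_form_le[OF B(1)] by blast
    \<comment> \<open>This puts \<open>s + 1 / K\<close> into \<open>S\<close>, against the choice
      of \<open>s\<close>.\<close>
    have "(s + 1 / K) * (v \<bullet> v) \<le> v \<bullet> (G *\<^sub>v v)" if v: "v \<in> carrier_vec n" for v
    proof -
      define u where "u = B *\<^sub>v v"
      have u: "u \<in> carrier_vec n" unfolding u_def using B v by simp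
      have Mu: "M *\<^sub>v u = v"
        unfolding u_def using assoc_mult_mat_vec[OF M B(1) v] B(2) v by simp
      define w where "w = v - (1 / K) \<cdot>\<^sub>v u"
      have w: "w \<in> carrier_vec n" unfolding w_def using u v by simp
      have "M *\<^sub>v w = M *\<^sub>v v - (1 / K) \<cdot>\<^sub>v v"
        unfolding w_def using M u v Mu by (simp add: mult_minus_distrib_mat_vec mult_mat_vec)
      \<comment> \<open>Both cross terms equal \<open>(v \<bullet> v) / K\<close>, since symmetry
        turns \<open>u \<bullet> (M *\<^sub>v v)\<close> into \<open>v \<bullet> v\<close>.\<close>
      then have "w \<bullet> (M *\<^sub>v w) = v \<bullet> (M *\<^sub>v v) - 2 * ((v \<bullet> v) / K) + (u \<bullet> v) / K\<^sup>2"
        unfolding w_def using u v M Msym[OF u v] Mu K(1)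
        by (simp add: minus_scalar_prod_distrib[of _ n] scalar_prod_minus_distrib[of _ n]
            field_simps power2_eq_square)
      moreover have "0 \<le> w \<bullet> (M *\<^sub>v w)"
        using sS[OF w] form[OF w] by simp
      moreover have "(u \<bullet> v) / K\<^sup>2 \<le> (v \<bullet> v) / K"
        using K(2)[OF v] K(1) comm_scalar_prod[OF u v]
        by (simp add: u_def divide_simps power2_eq_square abs_le_iff mult.commute)
      ultimately show ?thesis
        using form[OF v] by (simp add: distrib_right)
    qed
    then have "s + 1 / K \<in> S" unfolding S_def by blast
    then have "s + 1 / K \<le> s"
      unfolding s_def by (rule cSup_upper) (rule bdd)
    then show False using K(1) by simp
  qed
  then show thesis using that sS by blast
qed

section \<open>Gram matrices, singular values and ridge regression\<close>

lemma gram_form: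
  fixes A :: "real mat"
  assumes A: "A \<in> carrier_mat m n" and v: "v \<in> carrier_vec n"
  shows "v \<bullet> ((transpose_mat A * A) *\<^sub>v v) = (A *\<^sub>v v) \<bullet> (A *\<^sub>v v)"
proof -
  have "v \<bullet> ((transpose_mat A * A) *\<^sub>v v) = v \<bullet> (transpose_mat A *\<^sub>v (A *\<^sub>v v))"
    using assms by (subst assoc_mult_mat_vec) auto
  also have "\<dots> = (transpose_mat A *\<^sub>v (A *\<^sub>v v)) \<bullet> v"
    using assms by (intro comm_scalar_prod[of _ n]) auto
  also have "\<dots> = (A *\<^sub>v v) \<bullet> (A *\<^sub>v v)"
    using assms by (intro transpose_vec_mult_scalar) auto
  finally show ?thesis .
qed

text \<open>The smallest eigenvalue \<open>s\<close> of the Gram matrix bounds its form from below.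
  As \<open>m \<le> n\<close> selects this Gram matrix in \<open>singular_values\<close>,
  \<open>sqrt s\<close> is a singular value and \<open>sigma_min A\<close> is at most
  \<open>sqrt s\<close>.\<close>

lemma sigma_min_form_le:
  fixes A :: "real mat"
  assumes A: "A \<in> carrier_mat m n" and "m \<le> n" "0 < m" and v: "v \<in> carrier_vec m"
  shows "(sigma_min A)\<^sup>2 * (v \<bullet> v) \<le> v \<bullet> ((A * transpose_mat A) *\<^sub>v v)"
proof -
  define G where "G = A * transpose_mat A"
  have G: "G \<in> carrier_mat m m" unfolding G_def using A by simp
  have "transpose_mat G = G"
    unfolding G_def using transpose_mult[of A m n "transpose_mat A" m] A by simp
  then obtain s where s: "eigenvalue G s"
    and ge: "\<And>v. v \<in> carrier_vec m \<Longrightarrow> s * (v \<bullet> v) \<le> v \<bullet> (G *\<^sub>v v)"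
    using symmetric_obtain_min_eigenvalue[OF G _ \<open>0 < m\<close>] by blast
  have psd: "0 \<le> u \<bullet> (G *\<^sub>v u)" if "u \<in> carrier_vec m" for u
    using gram_form[of "transpose_mat A" n m u] A that
    by (simp add: G_def scalar_prod_self_nonneg)
  have eig_nonneg: "0 \<le> k" if k: "eigenvalue G k" for k
  proof -
    obtain u where u: "u \<in> carrier_vec m" "u \<noteq> 0\<^sub>v m" "G *\<^sub>v u = k \<cdot>\<^sub>v u"
      using k G unfolding eigenvalue_def eigenvector_def by auto
    have "u \<bullet> u > 0"
      using u scalar_prod_self_eq_0[OF u(1)] scalar_prod_self_nonneg[of u] by linarith
    moreover have "0 \<le> k * (u \<bullet> u)"
      using psd[OF u(1)] u by simp
    ultimately show ?thesis by (simp add: zero_le_mult_iff)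
  qed
  have sv: "singular_values A = sqrt ` {k. eigenvalue G k}"
    unfolding singular_values_def G_def using A \<open>m \<le> n\<close> by simp
  \<comment> \<open>Eigenvalues are roots of a nonzero polynomial, so \<open>Min\<close> ranges over
    a finite set.\<close>
  have "char_poly G \<noteq> 0"
    using degree_monic_char_poly[OF G] by auto
  then have fin: "finite (singular_values A)"
    unfolding sv eigenvalue_root_char_poly[OF G] by (intro finite_imageI poly_roots_finite)
  have mem: "sqrt s \<in> singular_values A" unfolding sv using s by blast
  have le: "sigma_min A \<le> sqrt s"
    unfolding sigma_min_def using fin mem by (rule Min_le)
  have "sigma_min A \<in> singular_values A"
    unfolding sigma_min_def using fin mem by (intro Min_in) auto
  then have "0 \<le> sigma_min A" unfolding sv using eig_nonneg by auto
  then have "(sigma_min A)\<^sup>2 \<le> s"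
    using power_mono[OF le, of 2] eig_nonneg[OF s] by simp
  then have "(sigma_min A)\<^sup>2 * (v \<bullet> v) \<le> s * (v \<bullet> v)"
    by (intro mult_right_mono scalar_prod_self_nonneg)
  with ge[OF v] show ?thesis by (simp add: G_def)
qed

text \<open>Let \<open>y\<close> solve \<open>(A * transpose_mat A + lam I) y = x\<close>. The dual
  form \<open>transpose_mat A *\<^sub>v y\<close> of the ridge solution attains the value
  \<open>lam * (y \<bullet> x)\<close>, and coercivity with constant \<open>\<mu> + lam\<close>
  bounds \<open>y \<bullet> x\<close>.\<close>

lemma ridge_regression_le:
  fixes A :: "real mat"
  assumes A: "A \<in> carrier_mat m n" and x: "x \<in> carrier_vec m" and "0 < lam" "0 \<le> \<mu>"
    and ge: "\<And>v. v \<in> carrier_vec m \<Longrightarrow> \<mu> * (v \<bullet> v) \<le> v \<bullet> ((A * transpose_mat A) *\<^sub>v v)"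
  obtains b where "b \<in> carrier_vec n"
    "(x - A *\<^sub>v b) \<bullet> (x - A *\<^sub>v b) + lam * (b \<bullet> b) \<le> lam * (x \<bullet> x) / (\<mu> + lam)"
proof -
  let ?G = "A * transpose_mat A"
  define M where "M = ?G + lam \<cdot>\<^sub>m 1\<^sub>m m"
  have G: "?G \<in> carrier_mat m m" using A by simp
  have M: "M \<in> carrier_mat m m" unfolding M_def using G by simp
  have Mv: "M *\<^sub>v v = ?G *\<^sub>v v + lam \<cdot>\<^sub>v v" if "v \<in> carrier_vec m" for v
    unfolding M_def using mult_add_scalar_mat_vec[OF G that] .
  have coer: "(\<mu> + lam) * (v \<bullet> v) \<le> v \<bullet> (M *\<^sub>v v)" if "v \<in> carrier_vec m" for v
    using ge[OF that] that G by (simp add: Mv scalar_prod_add_distrib[of _ m] algebra_simps del: assoc_mult_mat_vec)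
  have c: "0 < \<mu> + lam" using assms by simp
  obtain B where B: "B \<in> carrier_mat m m" "M * B = 1\<^sub>m m"
    using det_nonzero_obtain_inverse[OF M coercive_det_nonzero[OF M c coer]] by blast
  define y where "y = B *\<^sub>v x"
  have y: "y \<in> carrier_vec m" unfolding y_def using B x by simp
  have My: "M *\<^sub>v y = x"
    unfolding y_def using assoc_mult_mat_vec[OF M B(1) x] B(2) x by simp
  define b where "b = transpose_mat A *\<^sub>v y"
  have b: "b \<in> carrier_vec n" unfolding b_def using A y by simp
  have Ab: "A *\<^sub>v b = ?G *\<^sub>v y"
    unfolding b_def using A y by simp
  have Gy: "?G *\<^sub>v y \<in> carrier_vec m" using G y by (rule mult_mat_vec_carrier)
  have "g + lam \<cdot>\<^sub>v y - g = lam \<cdot>\<^sub>v y" if "g \<in> carrier_vec m" for g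
    using that y by (intro eq_vecI) auto
  \<comment> \<open>Subtracting \<open>A *\<^sub>v b\<close>, the Gram part of
    \<open>M *\<^sub>v y = x\<close>, leaves only the regularisation term.\<close>
  then have "x - A *\<^sub>v b = lam \<cdot>\<^sub>v y"
    unfolding Ab using My Mv[OF y] Gy by metis
  moreover have "b \<bullet> b = y \<bullet> (?G *\<^sub>v y)"
    using gram_form[of "transpose_mat A" n m y] A y unfolding b_def by simp
  ultimately have "(x - A *\<^sub>v b) \<bullet> (x - A *\<^sub>v b) + lam * (b \<bullet> b)
      = lam * (y \<bullet> (?G *\<^sub>v y) + lam * (y \<bullet> y))"
    using y by (simp add: algebra_simps)
  also have "y \<bullet> (?G *\<^sub>v y) + lam * (y \<bullet> y) = y \<bullet> x"
    using My[symmetric] Mv[OF y] Gy y by (simp add: scalar_prod_add_distrib[of _ m])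
  also have "lam * (y \<bullet> x) \<le> lam * (x \<bullet> x / (\<mu> + lam))"
  proof -
    \<comment> \<open>The squared norm of \<open>x - (\<mu> + lam) y\<close> is nonnegative;
      coercivity bounds its last term by half the cross term.\<close>
    have "0 \<le> x \<bullet> x - 2 * (\<mu> + lam) * (y \<bullet> x) + (\<mu> + lam)\<^sup>2 * (y \<bullet> y)"
      using scalar_prod_diff_self[OF x y, of "\<mu> + lam"] scalar_prod_self_nonneg[of "x - (\<mu> + lam) \<cdot>\<^sub>v y"]
      by simp
    moreover have "(\<mu> + lam) * ((\<mu> + lam) * (y \<bullet> y)) \<le> (\<mu> + lam) * (y \<bullet> x)"
      using coer[OF y] c My by (intro mult_left_mono) auto
    ultimately have "(\<mu> + lam) * (y \<bullet> x) \<le> x \<bullet> x"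
      unfolding power2_eq_square mult.assoc by linarith
    then have "y \<bullet> x \<le> x \<bullet> x / (\<mu> + lam)"
      using c by (simp add: pos_le_divide_eq mult.commute)
    then show ?thesis using \<open>0 < lam\<close> by (intro mult_left_mono) auto
  qed
  finally show thesis using that b by simp
qed

subsection \<open>The Cholesky factor\<close>

text \<open>Induction by eliminating the first row and column: the Schur complement \<open>B\<close>
  of \<open>A 0 0\<close> is again symmetric positive definite, and its factor becomes the lower
  right block. Matrices are functions here so that passing to the block is an index shift by
  \<open>Suc\<close>.\<close>

lemma cholesky_factor_exists:
  fixes A :: "nat \<Rightarrow> nat \<Rightarrow> real"
  assumes "\<And>i j. i < n \<Longrightarrow> j < n \<Longrightarrow> A i j = A j i"
    and "\<And>x. \<exists>i<n. x i \<noteq> 0 \<Longrightarrow> 0 < (\<Sum>i<n. \<Sum>j<n. x i * A i j * x j)"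
  shows "\<exists>L. (\<forall>i<n. \<forall>j<n. i < j \<longrightarrow> L i j = 0) \<and> (\<forall>i<n. 0 < L i i) \<and>
    (\<forall>i<n. \<forall>j<n. A i j = (\<Sum>k<n. L i k * L j k))"
  using assms
proof (induction n arbitrary: A)
  case 0
  then show ?case by simp
next
  case (Suc n)
  define a where "a = A 0 0"
  have "0 < (\<Sum>i<Suc n. \<Sum>j<Suc n. (case i of 0 \<Rightarrow> 1 | Suc _ \<Rightarrow> 0) * A i j * (case j of 0 \<Rightarrow> 1 | Suc _ \<Rightarrow> 0))"
    by (rule Suc.prems(2)) (auto intro!: exI[of _ 0])
  then have a: "0 < a"
    unfolding a_def by (simp only: sum.lessThan_Suc_shift) simp
  define B where "B i j = A (Suc i) (Suc j) - A (Suc i) 0 * A (Suc j) 0 / a" for i j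
  have "\<exists>L. (\<forall>i<n. \<forall>j<n. i < j \<longrightarrow> L i j = 0) \<and> (\<forall>i<n. 0 < L i i) \<and>
    (\<forall>i<n. \<forall>j<n. B i j = (\<Sum>k<n. L i k * L j k))"
  proof (rule Suc.IH)
    show "B i j = B j i" if "i < n" "j < n" for i j
      unfolding B_def using Suc.prems(1)[of "Suc i" "Suc j"] that by simp
  next
    fix y :: "nat \<Rightarrow> real" assume y: "\<exists>i<n. y i \<noteq> 0"
    define s where "s = (\<Sum>j<n. A (Suc j) 0 * y j)"
    \<comment> \<open>This first coordinate minimises the form of \<open>A\<close> for given
      \<open>y\<close>; completing the square leaves the form of the Schur complement.\<close>
    define x where "x = case_nat (- s / a) y"
    have "\<exists>i<Suc n. x i \<noteq> 0"
      using y unfolding x_def by (metis Suc_less_eq nat.simps(5))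
    then have "0 < (\<Sum>i<Suc n. \<Sum>j<Suc n. x i * A i j * x j)"
      by (rule Suc.prems(2))
    also have "\<dots> = x 0 * a * x 0 + (\<Sum>j<n. x 0 * A 0 (Suc j) * y j)
        + (\<Sum>i<n. y i * A (Suc i) 0 * x 0) + (\<Sum>i<n. \<Sum>j<n. y i * A (Suc i) (Suc j) * y j)"
      unfolding sum.lessThan_Suc_shift by (simp add: x_def a_def sum.distrib sum_subtractf sum_negf)
    also have "(\<Sum>j<n. x 0 * A 0 (Suc j) * y j) = x 0 * s"
      unfolding s_def sum_distrib_left
      by (intro sum.cong refl) (use Suc.prems(1)[of 0] in auto)
    also have "(\<Sum>i<n. y i * A (Suc i) 0 * x 0) = x 0 * s"
      unfolding s_def sum_distrib_left by (intro sum.cong refl) auto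
    also have "x 0 = - s / a" by (simp add: x_def)
    also have "(\<Sum>i<n. \<Sum>j<n. y i * A (Suc i) (Suc j) * y j)
        = (\<Sum>i<n. \<Sum>j<n. y i * B i j * y j) + s * s / a"
      unfolding s_def B_def sum_product sum_divide_distrib sum.distrib[symmetric]
      by (intro sum.cong refl) (simp add: algebra_simps)
    finally show "0 < (\<Sum>i<n. \<Sum>j<n. y i * B i j * y j)"
      using a by (simp add: field_simps)
  qed
  then obtain L where L: "\<And>i j. i < n \<Longrightarrow> j < n \<Longrightarrow> i < j \<Longrightarrow> L i j = 0" "\<And>i. i < n \<Longrightarrow> 0 < L i i"
    "\<And>i j. i < n \<Longrightarrow> j < n \<Longrightarrow> B i j = (\<Sum>k<n. L i k * L j k)" by blast
  \<comment> \<open>The factor of \<open>B\<close> is bordered by the first column of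
    \<open>A\<close> divided by \<open>sqrt a\<close>.\<close>
  define M where "M i j = (case i of 0 \<Rightarrow> (case j of 0 \<Rightarrow> sqrt a | Suc _ \<Rightarrow> 0)
    | Suc i \<Rightarrow> (case j of 0 \<Rightarrow> A (Suc i) 0 / sqrt a | Suc j \<Rightarrow> L i j))" for i j
  have M: "M 0 0 = sqrt a" "M 0 (Suc j) = 0" "M (Suc i) 0 = A (Suc i) 0 / sqrt a"
    "M (Suc i) (Suc j) = L i j" for i j
    by (simp_all add: M_def)
  have "A i j = (\<Sum>k<Suc n. M i k * M j k)" if ij: "i < Suc n" "j < Suc n" for i j
  proof (cases i)
    case 0
    then show ?thesis
      using a Suc.prems(1)[OF ij] by (cases j) (simp_all add: sum.lessThan_Suc_shift M a_def del: sum.lessThan_Suc)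
  next
    case (Suc i')
    show ?thesis
    proof (cases j)
      case 0
      then show ?thesis
        using a Suc by (simp add: sum.lessThan_Suc_shift M del: sum.lessThan_Suc)
    next
      case (Suc j')
      have "A i j = A (Suc i') 0 * A (Suc j') 0 / a + (\<Sum>k<n. L i' k * L j' k)"
        using ij \<open>i = Suc i'\<close> Suc L(3)[of i' j'] by (simp add: B_def)
      then show ?thesis
        using a \<open>i = Suc i'\<close> Suc by (simp add: sum.lessThan_Suc_shift M del: sum.lessThan_Suc)
    qed
  qed
  moreover have "M i j = 0" if "i < Suc n" "j < Suc n" "i < j" for i j
    using that L(1) by (auto simp: M_def split: nat.splits)
  moreover have "0 < M i i" if "i < Suc n" for i
    using that L(2) a by (auto simp: M_def split: nat.splits)
  ultimately show ?case by blast
qed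

lemma is_choleskyD:
  assumes "is_cholesky A L"
  shows "L \<in> carrier_mat (dim_row A) (dim_row A)"
    and "\<And>i j. i < j \<Longrightarrow> j < dim_row A \<Longrightarrow> L $$ (i, j) = 0"
    and "\<And>i. i < dim_row A \<Longrightarrow> 0 < L $$ (i, i)"
    and "A = L * transpose_mat L"
  using assms less_trans unfolding is_cholesky_def by blast+

text \<open>Triangularity cuts the sum after \<open>k = j\<close>, so that only column
  \<open>j\<close> and the columns before it occur, as the induction for uniqueness
  requires.\<close>

lemma is_cholesky_entry:
  assumes "is_cholesky A L" "i < dim_row A" "j < dim_row A"
  shows "A $$ (i, j) = (\<Sum>k<Suc j. L $$ (i, k) * L $$ (j, k))"
proof -
  note L = is_choleskyD[OF assms(1)]
  have "A $$ (i, j) = (L * transpose_mat L) $$ (i, j)"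
    using arg_cong[OF L(4), of "\<lambda>B. B $$ (i, j)"] .
  also have "\<dots> = (\<Sum>k<dim_row A. L $$ (i, k) * L $$ (j, k))"
    using L(1) assms by (subst index_mult_mat) (auto simp: scalar_prod_sum)
  also have "\<dots> = (\<Sum>k<Suc j. L $$ (i, k) * L $$ (j, k))"
    using assms L(2) by (intro sum.mono_neutral_right) auto
  finally show ?thesis .
qed

text \<open>Columns agree one after the other: the earlier columns cancel from entry
  \<open>(i, j)\<close>, leaving the product of that entry of the factor with the diagonal entry of
  column \<open>j\<close>.\<close>

lemma is_cholesky_unique:
  assumes L: "is_cholesky A L" and M: "is_cholesky A M"
  shows "L = M"
proof -
  let ?n = "dim_row A"
  note LD = is_choleskyD[OF L] and MD = is_choleskyD[OF M]
  have "\<forall>i<?n. L $$ (i, j) = M $$ (i, j)" if "j < ?n" for j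
    using that
  proof (induction j rule: less_induct)
    case (less j)
    have eq: "L $$ (i, j) * L $$ (j, j) = M $$ (i, j) * M $$ (j, j)" if "i < ?n" for i
    proof -
      have "(\<Sum>k<j. L $$ (i, k) * L $$ (j, k)) = (\<Sum>k<j. M $$ (i, k) * M $$ (j, k))"
        using less that by (intro sum.cong refl) auto
      then show ?thesis
        using is_cholesky_entry[OF L that less.prems] is_cholesky_entry[OF M that less.prems] by simp
    qed
    \<comment> \<open>For \<open>i = j\<close> two positive numbers have equal squares; the common
      diagonal entry then cancels for all \<open>i\<close>.\<close>
    have "L $$ (j, j) = M $$ (j, j)"
      using eq[OF less.prems] LD(3)[OF less.prems] MD(3)[OF less.prems]
      by (metis less_eq_real_def power2_eq_iff_nonneg power2_eq_square)
    then show ?case using eq LD(3)[OF less.prems] by auto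
  qed
  then show ?thesis using LD(1) MD(1) by (intro eq_matI) auto
qed

lemma is_cholesky_cholesky:
  assumes A: "A \<in> carrier_mat n n" and sym: "transpose_mat A = A"
    and pd: "\<And>v. v \<in> carrier_vec n \<Longrightarrow> v \<noteq> 0\<^sub>v n \<Longrightarrow> 0 < v \<bullet> (A *\<^sub>v v)"
  shows "is_cholesky A (cholesky A)"
proof -
  have "\<exists>L. (\<forall>i<n. \<forall>j<n. i < j \<longrightarrow> L i j = 0) \<and> (\<forall>i<n. 0 < L i i) \<and>
    (\<forall>i<n. \<forall>j<n. A $$ (i, j) = (\<Sum>k<n. L i k * L j k))"
  proof (rule cholesky_factor_exists)
    show "A $$ (i, j) = A $$ (j, i)" if "i < n" "j < n" for i j
      using that A arg_cong[OF sym, of "\<lambda>B. B $$ (i, j)"] by simp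
  next
    fix x :: "nat \<Rightarrow> real" assume "\<exists>i<n. x i \<noteq> 0"
    then have "vec n x \<noteq> 0\<^sub>v n" by (metis index_vec index_zero_vec(1))
    from pd[OF _ this] show "0 < (\<Sum>i<n. \<Sum>j<n. x i * A $$ (i, j) * x j)"
      using quadratic_form_sum[OF A, of "vec n x"] by simp
  qed
  then obtain L where L: "\<And>i j. i < n \<Longrightarrow> j < n \<Longrightarrow> i < j \<Longrightarrow> L i j = 0" "\<And>i. i < n \<Longrightarrow> 0 < L i i"
    "\<And>i j. i < n \<Longrightarrow> j < n \<Longrightarrow> A $$ (i, j) = (\<Sum>k<n. L i k * L j k)" by blast
  have ch: "is_cholesky A (mat n n (\<lambda>(i, j). L i j))"
    unfolding is_cholesky_def using A L
    by (auto intro!: eq_matI simp: scalar_prod_sum)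
  show ?thesis
    unfolding cholesky_def by (rule theI[where P = "is_cholesky A", OF ch]) (rule is_cholesky_unique[OF _ ch])
qed

subsection \<open>The Cholesky factor of the inverse Hessian\<close>

lemma hessian_carrier:
  assumes "X \<in> carrier_mat m N"
  shows "hessian X lam \<in> carrier_mat N N"
  using assms unfolding hessian_def by simp

lemma hessian_form:
  assumes X: "X \<in> carrier_mat m N" and v: "v \<in> carrier_vec N"
  shows "v \<bullet> (hessian X lam *\<^sub>v v) = (X *\<^sub>v v) \<bullet> (X *\<^sub>v v) + lam * (v \<bullet> v)"
proof -
  let ?G = "transpose_mat X * X"
  have G: "?G \<in> carrier_mat N N" using X by simp
  have "hessian X lam *\<^sub>v v = ?G *\<^sub>v v + lam \<cdot>\<^sub>v v"
    using mult_add_scalar_mat_vec[OF G v] X unfolding hessian_def by simp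
  moreover have "?G *\<^sub>v v \<in> carrier_vec N" using G v by (rule mult_mat_vec_carrier)
  ultimately show ?thesis
    using gram_form[OF X v] v by (simp add: scalar_prod_add_distrib[of _ N])
qed

lemma hessian_symmetric:
  assumes "X \<in> carrier_mat m N"
  shows "transpose_mat (hessian X lam) = hessian X lam"
proof -
  have "transpose_mat (transpose_mat X * X) = transpose_mat X * X"
    using transpose_mult[of "transpose_mat X" N m X N] assms by simp
  moreover have "transpose_mat (lam \<cdot>\<^sub>m 1\<^sub>m N) = lam \<cdot>\<^sub>m 1\<^sub>m N"
    by (intro eq_matI) auto
  ultimately show ?thesis
    using assms unfolding hessian_def by (simp add: transpose_add[of _ N N])
qed

text \<open>This is the matrix that \<open>optq_vec\<close> passes to \<open>optq_state\<close> when
  run with \<open>hessian X lam\<close>.\<close>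

definition optq_factor :: "real mat \<Rightarrow> real \<Rightarrow> real mat" where
  "optq_factor X lam = cholesky (the (mat_inverse (hessian X lam)))"

text \<open>The regularisation makes the Hessian coercive with constant \<open>lam\<close>. Its
  inverse therefore exists and is symmetric positive definite, so its Cholesky factor
  exists.\<close>

lemma optq_factor:
  assumes X: "X \<in> carrier_mat m N" and "0 < lam"
  defines "L \<equiv> optq_factor X lam"
  shows "L \<in> carrier_mat N N"
    and "\<And>i j. i < j \<Longrightarrow> j < N \<Longrightarrow> L $$ (i, j) = 0"
    and "\<And>i. i < N \<Longrightarrow> 0 < L $$ (i, i)"
    and "hessian X lam * (L * transpose_mat L) = 1\<^sub>m N"
proof -
  define H where "H = hessian X lam"
  have H: "H \<in> carrier_mat N N" unfolding H_def by (rule hessian_carrier[OF X])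
  have form: "lam * (v \<bullet> v) \<le> v \<bullet> (H *\<^sub>v v)" if "v \<in> carrier_vec N" for v
    using hessian_form[OF X that] scalar_prod_self_nonneg[of "X *\<^sub>v v"] unfolding H_def by simp
  obtain B where B: "mat_inverse H = Some B" "B \<in> carrier_mat N N" "H * B = 1\<^sub>m N" "B * H = 1\<^sub>m N"
    using det_nonzero_obtain_inverse[OF H coercive_det_nonzero[OF H \<open>0 < lam\<close> form]] by blast
  have symH: "transpose_mat H = H" unfolding H_def by (rule hessian_symmetric[OF X])
  have tB: "transpose_mat B * H = 1\<^sub>m N"
    using transpose_mult[OF H B(2)] B(3) symH by simp
  \<comment> \<open>A left and a right inverse of \<open>H\<close> coincide.\<close>
  have "transpose_mat B = transpose_mat B * (H * B)" using B by simp
  also have "\<dots> = B" using tB B(2) H by (subst assoc_mult_mat[symmetric]) auto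
  finally have sym: "transpose_mat B = B" .
  \<comment> \<open>The form of \<open>B\<close> at \<open>v\<close> is the form of \<open>H\<close>
    at \<open>B *\<^sub>v v\<close>.\<close>
  have pd: "0 < v \<bullet> (B *\<^sub>v v)" if v: "v \<in> carrier_vec N" "v \<noteq> 0\<^sub>v N" for v
  proof -
    define u where "u = B *\<^sub>v v"
    have u: "u \<in> carrier_vec N" unfolding u_def using B(2) v by simp
    have Hu: "H *\<^sub>v u = v" unfolding u_def
      using assoc_mult_mat_vec[OF H B(2) v(1)] B(3) v by simp
    then have "u \<noteq> 0\<^sub>v N" using v H by auto
    then have "0 < u \<bullet> u"
      using scalar_prod_self_eq_0[OF u] scalar_prod_self_nonneg[of u] by linarith
    then have "0 < u \<bullet> v" using form[OF u] Hu \<open>0 < lam\<close> by (smt (verit) mult_pos_pos)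
    then show ?thesis using comm_scalar_prod[OF u v(1)] unfolding u_def by simp
  qed
  have L: "L = cholesky B" unfolding L_def optq_factor_def using B(1) unfolding H_def by simp
  have "is_cholesky B L" unfolding L by (rule is_cholesky_cholesky[OF B(2) sym pd])
  then show "L \<in> carrier_mat N N" "\<And>i j. i < j \<Longrightarrow> j < N \<Longrightarrow> L $$ (i, j) = 0"
    "\<And>i. i < N \<Longrightarrow> 0 < L $$ (i, i)" "hessian X lam * (L * transpose_mat L) = 1\<^sub>m N"
    using is_choleskyD[of B L] B(2,3) unfolding H_def by (simp_all flip: is_choleskyD(4))
qed

text \<open>One-sided inverses of square matrices are two-sided, so
  \<open>transpose_mat L * H * L\<close> is the identity as well: the columns of \<open>L\<close>
  form an orthonormal basis for the form of \<open>H\<close>.\<close>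

lemma whitening:
  fixes H L :: "real mat"
  assumes H: "H \<in> carrier_mat n n" and L: "L \<in> carrier_mat n n"
    and inv: "H * (L * transpose_mat L) = 1\<^sub>m n"
  shows "v \<in> carrier_vec n \<Longrightarrow> (L *\<^sub>v v) \<bullet> (H *\<^sub>v (L *\<^sub>v v)) = v \<bullet> v"
    and "h \<in> carrier_vec n \<Longrightarrow> \<exists>g\<in>carrier_vec n. h = L *\<^sub>v g"
proof -
  have Lt: "transpose_mat L \<in> carrier_mat n n" using L by simp
  have "(H * L) * transpose_mat L = 1\<^sub>m n" using inv H L Lt by simp
  then have id: "transpose_mat L * (H * L) = 1\<^sub>m n"
    using mat_mult_left_right_inverse[of "H * L" n "transpose_mat L"] H L Lt by simp
  show "(L *\<^sub>v v) \<bullet> (H *\<^sub>v (L *\<^sub>v v)) = v \<bullet> v" if v: "v \<in> carrier_vec n"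
  proof -
    have "(L *\<^sub>v v) \<bullet> (H *\<^sub>v (L *\<^sub>v v)) = (H *\<^sub>v (L *\<^sub>v v)) \<bullet> (L *\<^sub>v v)"
      using H L v by (intro comm_scalar_prod[of _ n]) auto
    also have "\<dots> = (transpose_mat L *\<^sub>v (H *\<^sub>v (L *\<^sub>v v))) \<bullet> v"
      using H L v by (intro transpose_vec_mult_scalar[symmetric]) auto
    also have "transpose_mat L *\<^sub>v (H *\<^sub>v (L *\<^sub>v v)) = (transpose_mat L * (H * L)) *\<^sub>v v"
      using assoc_mult_mat_vec[OF Lt _ v, of "H * L"] assoc_mult_mat_vec[OF H L v] H L by simp
    finally show ?thesis using id v by simp
  qed
  have inv': "L * transpose_mat L * H = 1\<^sub>m n"
    using mat_mult_left_right_inverse[OF H _ inv] L by simp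
  show "\<exists>g\<in>carrier_vec n. h = L *\<^sub>v g" if h: "h \<in> carrier_vec n"
  proof
    have "h = (L * transpose_mat L * H) *\<^sub>v h" using inv' h by simp
    also have "\<dots> = L *\<^sub>v (transpose_mat L *\<^sub>v (H *\<^sub>v h))"
      using assoc_mult_mat_vec[OF _ H h, of "L * transpose_mat L" n]
        assoc_mult_mat_vec[OF L Lt, of "H *\<^sub>v h"] H L h by simp
    finally show "h = L *\<^sub>v (transpose_mat L *\<^sub>v (H *\<^sub>v h))" .
    show "transpose_mat L *\<^sub>v (H *\<^sub>v h) \<in> carrier_vec n" using H Lt h by simp
  qed
qed

text \<open>Writing \<open>h = L g\<close>, forward substitution gives \<open>g $ t = 1 / L $$ (t, t)\<close>, and the
  form of \<open>H\<close> at \<open>h\<close> is \<open>g \<bullet> g\<close>.\<close>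

lemma inverse_diagonal_le_form:
  fixes H L :: "real mat"
  assumes H: "H \<in> carrier_mat n n" and L: "L \<in> carrier_mat n n"
    and inv: "H * (L * transpose_mat L) = 1\<^sub>m n"
    and low: "\<And>i j. i < j \<Longrightarrow> j < n \<Longrightarrow> L $$ (i, j) = 0"
    and diag: "\<And>i. i < n \<Longrightarrow> 0 < L $$ (i, i)"
    and h: "h \<in> carrier_vec n" "\<And>i. i < t \<Longrightarrow> h $ i = 0" "h $ t = 1" and "t < n"
  shows "1 / (L $$ (t, t))\<^sup>2 \<le> h \<bullet> (H *\<^sub>v h)"
proof -
  obtain g where g: "g \<in> carrier_vec n" "h = L *\<^sub>v g"
    using whitening(2)[OF H L inv h(1)] by blast
  have expand: "h $ i = (\<Sum>k<Suc i. L $$ (i, k) * g $ k)" if "i < n" for i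
    unfolding g(2) mult_mat_vec_sum[OF L g(1) that]
    using that low by (intro sum.mono_neutral_right) auto
  have zero: "g $ i = 0" if "i < t" for i
    using that
  proof (induction i rule: less_induct)
    case (less i)
    then have "h $ i = L $$ (i, i) * g $ i" using expand[of i] \<open>t < n\<close> by simp
    then show ?case using h(2)[OF less.prems] diag[of i] less.prems \<open>t < n\<close> by simp
  qed
  have "1 = L $$ (t, t) * g $ t" using expand[OF \<open>t < n\<close>] h(3) zero by simp
  then have "g $ t = 1 / L $$ (t, t)" using diag[OF \<open>t < n\<close>] by (simp add: field_simps)
  then have "1 / (L $$ (t, t))\<^sup>2 = (g $ t)\<^sup>2" by (simp add: power_divide)
  also have "\<dots> \<le> g \<bullet> g" using square_nth_le_scalar_prod_self[of t g] g \<open>t < n\<close> by simp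
  also have "\<dots> = h \<bullet> (H *\<^sub>v h)" using whitening(1)[OF H L inv g(1)] g(2) by simp
  finally show ?thesis .
qed

text \<open>The sum is \<open>s \<bullet> s\<close> for
  \<open>s = transpose_mat L *\<^sub>v u\<close>. The hypothesis at \<open>y = L *\<^sub>v s\<close>
  reads \<open>(s \<bullet> s)\<^sup>2 \<le> s \<bullet> s\<close> after whitening.\<close>

lemma sum_square_columns_le_1:
  fixes H L :: "real mat"
  assumes H: "H \<in> carrier_mat n n" and L: "L \<in> carrier_mat n n"
    and inv: "H * (L * transpose_mat L) = 1\<^sub>m n" and u: "u \<in> carrier_vec n"
    and le: "\<And>y. y \<in> carrier_vec n \<Longrightarrow> (u \<bullet> y)\<^sup>2 \<le> y \<bullet> (H *\<^sub>v y)"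
  shows "(\<Sum>t<n. (u \<bullet> col L t)\<^sup>2) \<le> 1"
proof -
  define s where "s = transpose_mat L *\<^sub>v u"
  have s: "s \<in> carrier_vec n" unfolding s_def using L u by simp
  have "u \<bullet> (L *\<^sub>v s) = s \<bullet> s"
    using transpose_vec_mult_scalar[OF L s u] unfolding s_def by simp
  then have "(s \<bullet> s)\<^sup>2 \<le> s \<bullet> s"
    using le[of "L *\<^sub>v s"] L s whitening(1)[OF H L inv s] by simp
  then have "s \<bullet> s \<le> 1"
    using scalar_prod_self_nonneg[of s]
    by (cases "s \<bullet> s = 0") (simp_all add: power2_eq_square mult_le_cancel_right)
  moreover have "s \<bullet> s = (\<Sum>t<n. (u \<bullet> col L t)\<^sup>2)"
    unfolding scalar_prod_sum[of s s] power2_eq_square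
    using L s u comm_scalar_prod[OF u] by (intro sum.cong) (auto simp: s_def)
  ultimately show ?thesis by simp
qed

lemma sum_split_at:
  fixes f :: "nat \<Rightarrow> 'a :: comm_monoid_add"
  assumes "t < n"
  shows "(\<Sum>j<n. f j) = (\<Sum>j<t. f j) + f t + (\<Sum>k<n - Suc t. f (Suc t + k))"
proof -
  have "(\<Sum>j<n. f j) = (\<Sum>j<Suc t. f j) + (\<Sum>j=Suc t..<n. f j)"
    using assms by (metis Suc_leI atLeast0LessThan sum.atLeastLessThan_concat le0)
  also have "(\<Sum>j=Suc t..<n. f j) = (\<Sum>k<n - Suc t. f (Suc t + k))"
    using assms by (simp add: sum.atLeastLessThan_shift_0 atLeast0LessThan)
  finally show ?thesis by simp
qed

text \<open>Every \<open>h\<close> with zeros before position \<open>t\<close> and one at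
  \<open>t\<close> gives an upper bound through \<open>inverse_diagonal_le_form\<close>. The two
  ranges of indices in \<open>C_inf\<close> correspond to two choices of \<open>h\<close>.\<close>

lemma inverse_diagonal_le_C_inf:
  assumes X: "X \<in> carrier_mat m N" and "0 < m" "0 < lam" "t < N"
  shows "1 / (optq_factor X lam $$ (t, t))\<^sup>2 \<le> (C_inf X lam)\<^sup>2" "0 \<le> C_inf X lam"
proof -
  define L where "L = optq_factor X lam"
  define S where "S = {lam * (l2_norm (col X j))\<^sup>2 / ((sigma_min (drop_cols (Suc j) X))\<^sup>2 + lam) | j.
           j < N \<and> j + m < N} \<union> {(l2_norm (col X j))\<^sup>2 | j. j < N \<and> N \<le> j + m}"
  note fac = optq_factor[OF X \<open>0 < lam\<close>, folded L_def]
  have C: "C_inf X lam = sqrt (Max S + lam)"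
    unfolding C_inf_def S_def Let_def using X by simp
  have fin: "finite S" unfolding S_def by simp
  have "\<exists>h s. h \<in> carrier_vec N \<and> (\<forall>i<t. h $ i = 0) \<and> h $ t = 1 \<and> s \<in> S \<and> h \<bullet> (hessian X lam *\<^sub>v h) \<le> s + lam"
  proof (cases "t + m < N")
    case False
    have Xt: "X *\<^sub>v unit_vec N t = col X t"
      using X \<open>t < N\<close> by (intro eq_vecI) auto
    have "unit_vec N t \<bullet> (hessian X lam *\<^sub>v unit_vec N t) = (l2_norm (col X t))\<^sup>2 + lam"
      using hessian_form[OF X, of "unit_vec N t" lam] \<open>t < N\<close>
      by (simp add: Xt l2_norm_squared)
    then show ?thesis
      using False \<open>t < N\<close> unfolding S_def
      by (intro exI[of _ "unit_vec N t"] exI[of _ "(l2_norm (col X t))\<^sup>2"]) auto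
  next
    case True
    define A where "A = drop_cols (Suc t) X"
    have A: "A \<in> carrier_mat m (N - Suc t)"
      unfolding A_def drop_cols_def using X by simp
    have x: "col X t \<in> carrier_vec m" using X \<open>t < N\<close> by simp
    \<comment> \<open>The case assumption says that \<open>A\<close> has at least \<open>m\<close>
      columns, so the square of \<open>sigma_min A\<close> can serve as
      \<open>\<mu>\<close>.\<close>
    obtain b where b: "b \<in> carrier_vec (N - Suc t)"
      "(col X t - A *\<^sub>v b) \<bullet> (col X t - A *\<^sub>v b) + lam * (b \<bullet> b)
        \<le> lam * (col X t \<bullet> col X t) / ((sigma_min A)\<^sup>2 + lam)"
      using ridge_regression_le[OF A x \<open>0 < lam\<close> zero_le_power2 sigma_min_form_le[OF A _ \<open>0 < m\<close>]] True
      by (metis add_Suc le_diff_conv2 Suc_leI add.commute Suc_leI[OF \<open>t < N\<close>])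
    \<comment> \<open>The entries \<open>- b\<close> to the right of \<open>t\<close> make
      \<open>X *\<^sub>v h\<close> the regression residual.\<close>
    define h where "h = vec N (\<lambda>i. if i < t then 0 else if i = t then 1 else - b $ (i - Suc t))"
    have h: "h \<in> carrier_vec N" unfolding h_def by simp
    have "X *\<^sub>v h = col X t - A *\<^sub>v b"
    proof (rule eq_vecI)
      fix i assume "i < dim_vec (col X t - A *\<^sub>v b)"
      then have i: "i < m" using A by simp
      have "(X *\<^sub>v h) $ i = X $$ (i, t) - (\<Sum>k<N - Suc t. X $$ (i, Suc t + k) * b $ k)"
        unfolding mult_mat_vec_sum[OF X h i] sum_split_at[OF \<open>t < N\<close>]
        using \<open>t < N\<close> by (simp add: h_def sum_negf)
      also have "(\<Sum>k<N - Suc t. X $$ (i, Suc t + k) * b $ k) = (A *\<^sub>v b) $ i"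
        unfolding mult_mat_vec_sum[OF A b(1) i]
        using X i by (intro sum.cong refl) (auto simp: A_def drop_cols_def)
      finally show "(X *\<^sub>v h) $ i = (col X t - A *\<^sub>v b) $ i"
        using X A i \<open>t < N\<close> by simp
    qed (use X A in auto)
    \<comment> \<open>The summand 1, from position \<open>t\<close>, produces the final
      \<open>+ lam\<close> in \<open>C_inf\<close>.\<close>
    moreover have "h \<bullet> h = 1 + b \<bullet> b"
    proof -
      have "h \<bullet> h = (\<Sum>i<N. h $ i * h $ i)" unfolding scalar_prod_sum using h by simp
      also have "\<dots> = 1 + (\<Sum>k<N - Suc t. b $ k * b $ k)"
        unfolding sum_split_at[OF \<open>t < N\<close>] using \<open>t < N\<close> by (simp add: h_def)
      finally show ?thesis unfolding scalar_prod_sum using b(1) by simp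
    qed
    ultimately have "h \<bullet> (hessian X lam *\<^sub>v h)
        \<le> lam * (l2_norm (col X t))\<^sup>2 / ((sigma_min A)\<^sup>2 + lam) + lam"
      using hessian_form[OF X h, of lam] b(2) by (simp add: l2_norm_squared algebra_simps)
    then show ?thesis
      using True \<open>t < N\<close> h unfolding S_def A_def
      by (intro exI[of _ h] exI[of _ "lam * (l2_norm (col X t))\<^sup>2 / ((sigma_min (drop_cols (Suc t) X))\<^sup>2 + lam)"])
        (auto simp: h_def)
  qed
  then obtain h s where hs: "h \<in> carrier_vec N" "\<And>i. i < t \<Longrightarrow> h $ i = 0" "h $ t = 1" "s \<in> S"
    "h \<bullet> (hessian X lam *\<^sub>v h) \<le> s + lam" by blast
  have "1 / (L $$ (t, t))\<^sup>2 \<le> h \<bullet> (hessian X lam *\<^sub>v h)"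
    by (rule inverse_diagonal_le_form[OF hessian_carrier[OF X] fac(1,4,2,3) hs(1,2,3) \<open>t < N\<close>])
  also have "\<dots> \<le> Max S + lam"
    using hs(5) Max_ge[OF fin hs(4)] by simp
  finally have le: "1 / (L $$ (t, t))\<^sup>2 \<le> Max S + lam" .
  \<comment> \<open>The radicand dominates the reciprocal of a square, so squaring its root gives it
    back.\<close>
  then have "0 \<le> Max S + lam" by (rule order_trans[rotated]) simp
  then show "1 / (optq_factor X lam $$ (t, t))\<^sup>2 \<le> (C_inf X lam)\<^sup>2" "0 \<le> C_inf X lam"
    using le unfolding C L_def by simp_all
qed

text \<open>The squares of \<open>u \<bullet> col L t\<close> sum to at most 1, and each weight is
  at most the square of \<open>C_inf X lam\<close>. The sum governs the variance proxy of
  \<open>u \<bullet> (q - w)\<close>.\<close>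

lemma sum_square_increments_le_C_inf:
  assumes X: "X \<in> carrier_mat m N" and "0 < m" "0 < lam" and u: "u \<in> carrier_vec N"
    and le: "\<And>y. y \<in> carrier_vec N \<Longrightarrow> (u \<bullet> y)\<^sup>2 \<le> y \<bullet> (hessian X lam *\<^sub>v y)"
  defines "L \<equiv> optq_factor X lam"
  shows "(\<Sum>t<N. ((u \<bullet> col L t) / L $$ (t, t))\<^sup>2) \<le> (C_inf X lam)\<^sup>2"
proof -
  note fac = optq_factor[OF X \<open>0 < lam\<close>, folded L_def]
  have "(\<Sum>t<N. ((u \<bullet> col L t) / L $$ (t, t))\<^sup>2) = (\<Sum>t<N. (u \<bullet> col L t)\<^sup>2 * (1 / (L $$ (t, t))\<^sup>2))"
    by (simp add: power_divide)
  also have "\<dots> \<le> (\<Sum>t<N. (u \<bullet> col L t)\<^sup>2 * (C_inf X lam)\<^sup>2)"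
    using inverse_diagonal_le_C_inf(1)[OF X \<open>0 < m\<close> \<open>0 < lam\<close>]
    by (intro sum_mono mult_left_mono) (auto simp: L_def)
  also have "\<dots> \<le> 1 * (C_inf X lam)\<^sup>2"
    unfolding sum_distrib_right[symmetric]
    using sum_square_columns_le_1[OF hessian_carrier[OF X] fac(1,4) u le]
    by (intro mult_right_mono) auto
  finally show ?thesis by simp
qed

subsection \<open>Sub-Gaussian concentration of the rounding errors\<close>

text \<open>Hoeffding's lemma applies: the rounding error has mean zero and takes only the values
  \<open>a\<close> and \<open>a + \<delta>\<close>.\<close>

lemma Q_stoc_mgf:
  assumes "0 < \<delta>"
  shows "(\<integral>\<^sup>+q. ennreal (exp (l * (q - z))) \<partial>Q_stoc \<delta> z) \<le> ennreal (exp (l\<^sup>2 * \<delta>\<^sup>2 / 8))"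
proof -
  define p where "p = 1 - z / \<delta> + of_int \<lfloor>z / \<delta>\<rfloor>"
  define a where "a = of_int \<lfloor>z / \<delta>\<rfloor> * \<delta> - z"
  have p: "0 \<le> p" "p \<le> 1" unfolding p_def by linarith+
  have Q: "Q_stoc \<delta> z = map_pmf (\<lambda>down. if down then z + a else z + a + \<delta>) (bernoulli_pmf p)"
    unfolding Q_stoc_def p_def a_def by (intro map_pmf_cong refl) (simp add: algebra_simps)
  have E0: "measure_pmf.expectation (Q_stoc \<delta> z) (\<lambda>q. q - z) = 0"
    unfolding Q using p assms by (simp add: p_def a_def field_simps)
  have supp: "q \<in> {z + a, z + a + \<delta>}" if "q \<in> set_pmf (Q_stoc \<delta> z)" for q
    using that unfolding Q by (auto split: if_splits)
  show ?thesis
  proof (cases l "0 :: real" rule: linorder_cases)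
    case equal
    then show ?thesis by simp
  next
    case greater
    interpret interval_bounded_random_variable "measure_pmf (Q_stoc \<delta> z)" "\<lambda>q. q - z" a "a + \<delta>"
      using supp assms by unfold_locales (force simp: AE_measure_pmf_iff)+
    show ?thesis using Hoeffdings_lemma_nn_integral_0[OF greater E0] by simp
  next
    \<comment> \<open>A negative exponent is handled by reflecting the error.\<close>
    case less
    interpret interval_bounded_random_variable "measure_pmf (Q_stoc \<delta> z)" "\<lambda>q. z - q" "- (a + \<delta>)" "- a"
      using supp assms by unfold_locales (force simp: AE_measure_pmf_iff)+
    have "measure_pmf.expectation (Q_stoc \<delta> z) (\<lambda>q. z - q) = 0"
      using E0 Bochner_Integration.integral_minus[of "Q_stoc \<delta> z" "\<lambda>q. q - z"] by simp
    from Hoeffdings_lemma_nn_integral_0[OF _ this, of "- l"] less show ?thesis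
      by (simp add: algebra_simps)
  qed
qed

text \<open>The induction follows a hybrid vector, with outputs before position \<open>t\<close> and
  working entries from \<open>t\<close> on. It is \<open>w\<close> for \<open>t = 0\<close> and the
  output for \<open>t = N\<close>.\<close>

lemma optq_state_mgf:
  fixes u :: "nat \<Rightarrow> real" and L :: "real mat"
  assumes "0 < \<delta>" and N: "dim_vec w = N"
    and low: "\<And>i j. i < j \<Longrightarrow> j < N \<Longrightarrow> L $$ (i, j) = 0"
    and diag: "\<And>i. i < N \<Longrightarrow> L $$ (i, i) \<noteq> 0"
  defines "c \<equiv> \<lambda>t. (\<Sum>i<N. u i * L $$ (i, t)) / L $$ (t, t)"
  assumes "t \<le> N"
  shows "(\<integral>\<^sup>+(v, q). ennreal (exp (s * (\<Sum>i<N. u i * ((if i < t then q $ i else v $ i) - w $ i))))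
      \<partial>optq_state \<delta> L w t) \<le> ennreal (exp (s\<^sup>2 * \<delta>\<^sup>2 / 8 * (\<Sum>k<t. (c k)\<^sup>2)))"
  using \<open>t \<le> N\<close>
proof (induction t)
  case 0
  then show ?case by simp
next
  case (Suc t)
  then have t: "t < N" by simp
  define r where "r t = (\<lambda>(v :: real vec, q :: real vec).
    \<Sum>i<N. u i * ((if i < t then q $ i else v $ i) - w $ i))" for t
  define upd where "upd vq qt = (case vq of (v, q) \<Rightarrow>
    (vec N (\<lambda>i. if t < i then v $ i + (qt - v $ t) * L $$ (i, t) / L $$ (t, t) else v $ i),
     vec N (\<lambda>i. if i = t then qt else q $ i)))" for vq :: "real vec \<times> real vec" and qt
  \<comment> \<open>The hybrid moves by a multiple of column \<open>t\<close> of \<open>L\<close>: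
    entries before \<open>t\<close> stay since \<open>L\<close> vanishes there, entry
    \<open>t\<close> goes from \<open>v $ t\<close> to \<open>qt\<close>, and later entries get the
    OPTQ correction.\<close>
  have r_upd: "r (Suc t) (upd (v, q) qt) = r t (v, q) + (qt - v $ t) * c t" for v q qt
  proof -
    have "u i * ((if i < Suc t then snd (upd (v, q) qt) $ i else fst (upd (v, q) qt) $ i) - w $ i)
      = u i * ((if i < t then q $ i else v $ i) - w $ i)
        + (qt - v $ t) * (u i * L $$ (i, t) / L $$ (t, t))" if "i < N" for i
      using that low[of i t] diag[of t] t
      by (cases i t rule: linorder_cases) (auto simp: upd_def algebra_simps)
    then show ?thesis
      unfolding r_def c_def case_prod_beta fst_conv snd_conv
      by (simp add: sum.distrib sum_distrib_left sum_divide_distrib)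
  qed
  \<comment> \<open>Given the state, only the fresh rounding is random, and
    \<open>Q_stoc_mgf\<close> applies with exponent \<open>s * c t\<close>.\<close>
  have step: "(\<integral>\<^sup>+qt. ennreal (exp (s * r (Suc t) (upd vq qt))) \<partial>Q_stoc \<delta> (fst vq $ t))
      \<le> ennreal (exp (s * r t vq)) * ennreal (exp ((s * c t)\<^sup>2 * \<delta>\<^sup>2 / 8))" for vq
  proof -
    obtain v q where vq: "vq = (v, q)" by (cases vq)
    have "(\<integral>\<^sup>+qt. ennreal (exp (s * r (Suc t) (upd vq qt))) \<partial>Q_stoc \<delta> (fst vq $ t))
      = (\<integral>\<^sup>+qt. ennreal (exp (s * r t vq)) * ennreal (exp (s * c t * (qt - v $ t))) \<partial>Q_stoc \<delta> (v $ t))"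
      unfolding vq r_upd
      by (simp add: algebra_simps flip: ennreal_mult' exp_add)
    also have "\<dots> = ennreal (exp (s * r t vq)) * (\<integral>\<^sup>+qt. ennreal (exp (s * c t * (qt - v $ t))) \<partial>Q_stoc \<delta> (v $ t))"
      by (rule nn_integral_cmult) simp
    also have "\<dots> \<le> ennreal (exp (s * r t vq)) * ennreal (exp ((s * c t)\<^sup>2 * \<delta>\<^sup>2 / 8))"
      by (intro mult_left_mono Q_stoc_mgf \<open>0 < \<delta>\<close>) simp
    finally show ?thesis .
  qed
  have state: "optq_state \<delta> L w (Suc t) = bind_pmf (optq_state \<delta> L w t)
      (\<lambda>vq. bind_pmf (Q_stoc \<delta> (fst vq $ t)) (\<lambda>qt. return_pmf (upd vq qt)))"
    using N by (simp add: upd_def case_prod_beta')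
  have "(\<integral>\<^sup>+vq. ennreal (exp (s * r (Suc t) vq)) \<partial>optq_state \<delta> L w (Suc t))
      = (\<integral>\<^sup>+vq. \<integral>\<^sup>+qt. ennreal (exp (s * r (Suc t) (upd vq qt))) \<partial>Q_stoc \<delta> (fst vq $ t) \<partial>optq_state \<delta> L w t)"
    unfolding state by simp
  also have "\<dots> \<le> (\<integral>\<^sup>+vq. ennreal (exp (s * r t vq)) * ennreal (exp ((s * c t)\<^sup>2 * \<delta>\<^sup>2 / 8)) \<partial>optq_state \<delta> L w t)"
    by (intro nn_integral_mono step)
  also have "\<dots> = (\<integral>\<^sup>+vq. ennreal (exp (s * r t vq)) \<partial>optq_state \<delta> L w t) * ennreal (exp ((s * c t)\<^sup>2 * \<delta>\<^sup>2 / 8))"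
    by (rule nn_integral_multc) simp
  also have "\<dots> \<le> ennreal (exp (s\<^sup>2 * \<delta>\<^sup>2 / 8 * (\<Sum>k<t. (c k)\<^sup>2))) * ennreal (exp ((s * c t)\<^sup>2 * \<delta>\<^sup>2 / 8))"
    using Suc by (intro mult_right_mono) (simp_all add: r_def case_prod_beta)
  also have "\<dots> = ennreal (exp (s\<^sup>2 * \<delta>\<^sup>2 / 8 * (\<Sum>k<Suc t. (c k)\<^sup>2)))"
    by (simp add: algebra_simps power_mult_distrib flip: ennreal_mult' exp_add)
  finally show ?case
    by (simp add: r_def case_prod_beta del: optq_state.simps)
qed

text \<open>Chernoff's bound for both signs, with variance proxy \<open>B\<close>; the exponent
  \<open>s = \<tau> / B\<close> minimises \<open>s\<^sup>2 * B / 2 - s * \<tau>\<close>.\<close>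

lemma subgaussian_tail:
  fixes f :: "'a \<Rightarrow> real"
  assumes mgf: "\<And>s. (\<integral>\<^sup>+x. ennreal (exp (s * f x)) \<partial>measure_pmf M) \<le> ennreal (exp (s\<^sup>2 * B / 2))"
    and "0 < B" "0 \<le> \<tau>"
  shows "measure_pmf.prob M {x. \<tau> < \<bar>f x\<bar>} \<le> 2 * exp (- \<tau>\<^sup>2 / (2 * B))"
proof (cases "\<tau> = 0")
  \<comment> \<open>Here the claimed bound is 2, while the Chernoff exponent would degenerate to
    zero.\<close>
  case True
  then show ?thesis by (simp add: order_trans[OF measure_pmf.prob_le_1])
next
  case False
  then have \<tau>: "0 < \<tau>" using assms by simp
  have one_sided: "measure_pmf.prob M {x. \<tau> \<le> \<sigma> * f x} \<le> exp (- \<tau>\<^sup>2 / (2 * B))" if \<sigma>: "\<sigma>\<^sup>2 = 1" for \<sigma> :: real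
  proof -
    define s where "s = \<tau> / B"
    have s: "0 < s" unfolding s_def using \<tau> \<open>0 < B\<close> by simp
    have "emeasure M {x \<in> UNIV. \<sigma> * f x \<ge> \<tau>}
        \<le> ennreal (exp (- s * \<tau>)) * (\<integral>\<^sup>+x. ennreal (exp (s * (\<sigma> * f x))) * indicator UNIV x \<partial>M)"
      by (rule Chernoff_ineq_nn_integral_ge[OF s]) auto
    also have "\<dots> = ennreal (exp (- s * \<tau>)) * (\<integral>\<^sup>+x. ennreal (exp ((s * \<sigma>) * f x)) \<partial>M)"
      by (simp add: mult.assoc)
    also have "\<dots> \<le> ennreal (exp (- s * \<tau>)) * ennreal (exp ((s * \<sigma>)\<^sup>2 * B / 2))"
      by (intro mult_left_mono mgf) simp
    also have "\<dots> = ennreal (exp (- \<tau>\<^sup>2 / (2 * B)))"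
      using \<open>0 < B\<close> \<sigma>
      by (simp add: s_def power_mult_distrib field_simps power2_eq_square flip: ennreal_mult' exp_add)
    finally show ?thesis by (simp add: measure_pmf.emeasure_eq_measure)
  qed
  have "measure_pmf.prob M {x. \<tau> < \<bar>f x\<bar>} \<le> measure_pmf.prob M ({x. \<tau> \<le> 1 * f x} \<union> {x. \<tau> \<le> (- 1) * f x})"
    by (intro measure_pmf.finite_measure_mono) (auto simp: abs_real_def split: if_splits)
  also have "\<dots> \<le> measure_pmf.prob M {x. \<tau> \<le> 1 * f x} + measure_pmf.prob M {x. \<tau> \<le> (- 1) * f x}"
    by (intro measure_Un_le) auto
  also have "\<dots> \<le> exp (- \<tau>\<^sup>2 / (2 * B)) + exp (- \<tau>\<^sup>2 / (2 * B))"
    by (intro add_mono one_sided) simp_all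
  finally show ?thesis by simp
qed

lemma optq_vec_tail:
  assumes X: "X \<in> carrier_mat m N" and "0 < m" "0 < lam" "0 < \<delta>" "0 < N" "0 \<le> \<kappa>"
    and w: "w \<in> carrier_vec N" and u: "u \<in> carrier_vec N"
    and le: "\<And>y. y \<in> carrier_vec N \<Longrightarrow> (u \<bullet> y)\<^sup>2 \<le> y \<bullet> (hessian X lam *\<^sub>v y)"
  shows "measure_pmf.prob (optq_vec \<delta> (hessian X lam) w)
      {q. \<delta> * sqrt (2 * pi * \<kappa>) * C_inf X lam < \<bar>\<Sum>i<N. u $ i * (q $ i - w $ i)\<bar>}
    \<le> 2 * exp (- 4 * pi * \<kappa>)"
proof -
  define L where "L = optq_factor X lam"
  note fac = optq_factor[OF X \<open>0 < lam\<close>, folded L_def]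
  define C where "C = C_inf X lam"
  have diag: "L $$ (i, i) \<noteq> 0" if "i < N" for i using fac(3)[OF that] by simp
  \<comment> \<open>One diagonal entry already shows that \<open>C\<close> is nonzero, so the
    variance proxy is positive.\<close>
  have "0 < 1 / (L $$ (0, 0))\<^sup>2" using diag[OF \<open>0 < N\<close>] by simp
  then have C: "0 < C\<^sup>2" "0 \<le> C"
    using inverse_diagonal_le_C_inf[OF X \<open>0 < m\<close> \<open>0 < lam\<close> \<open>0 < N\<close>] unfolding C_def L_def by linarith+
  have vec: "optq_vec \<delta> (hessian X lam) w = map_pmf snd (optq_state \<delta> L w N)"
    using w unfolding optq_vec_def L_def optq_factor_def by simp
  have u_col: "(\<Sum>i<N. u $ i * L $$ (i, t)) = u \<bullet> col L t" if "t < N" for t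
    using that fac(1) by (simp add: scalar_prod_sum)
  have "(\<integral>\<^sup>+q. ennreal (exp (s * (\<Sum>i<N. u $ i * (q $ i - w $ i)))) \<partial>optq_vec \<delta> (hessian X lam) w)
      \<le> ennreal (exp (s\<^sup>2 * (\<delta>\<^sup>2 * C\<^sup>2 / 4) / 2))" for s
  proof -
    have "(\<integral>\<^sup>+q. ennreal (exp (s * (\<Sum>i<N. u $ i * (q $ i - w $ i)))) \<partial>optq_vec \<delta> (hessian X lam) w)
      = (\<integral>\<^sup>+(v, q). ennreal (exp (s * (\<Sum>i<N. u $ i * ((if i < N then q $ i else v $ i) - w $ i)))) \<partial>optq_state \<delta> L w N)"
      unfolding vec by (simp add: case_prod_beta')
    also have "\<dots> \<le> ennreal (exp (s\<^sup>2 * \<delta>\<^sup>2 / 8 * (\<Sum>t<N. ((\<Sum>i<N. u $ i * L $$ (i, t)) / L $$ (t, t))\<^sup>2)))"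
      using w by (intro optq_state_mgf \<open>0 < \<delta>\<close> fac(2) diag) auto
    also have "\<dots> \<le> ennreal (exp (s\<^sup>2 * \<delta>\<^sup>2 / 8 * C\<^sup>2))"
      using sum_square_increments_le_C_inf[OF X \<open>0 < m\<close> \<open>0 < lam\<close> u le, folded L_def C_def]
      by (intro ennreal_leI) (auto simp: u_col intro!: mult_left_mono)
    finally show ?thesis by (simp add: mult.assoc)
  qed
  then have "measure_pmf.prob (optq_vec \<delta> (hessian X lam) w)
      {q. \<delta> * sqrt (2 * pi * \<kappa>) * C < \<bar>\<Sum>i<N. u $ i * (q $ i - w $ i)\<bar>}
    \<le> 2 * exp (- (\<delta> * sqrt (2 * pi * \<kappa>) * C)\<^sup>2 / (2 * (\<delta>\<^sup>2 * C\<^sup>2 / 4)))"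
    using C \<open>0 < \<delta>\<close> \<open>0 \<le> \<kappa>\<close> by (intro subgaussian_tail) (auto simp: mult.assoc)
  \<comment> \<open>With variance proxy \<open>\<delta>\<^sup>2 * C\<^sup>2 / 4\<close>, the factor
    \<open>2 * pi\<close> of the squared threshold doubles to \<open>4 * pi\<close>.\<close>
  also have "- (\<delta> * sqrt (2 * pi * \<kappa>) * C)\<^sup>2 / (2 * (\<delta>\<^sup>2 * C\<^sup>2 / 4)) = - 4 * pi * \<kappa>"
    using C \<open>0 < \<delta>\<close> \<open>0 \<le> \<kappa>\<close> by (simp add: power_mult_distrib field_simps)
  finally show ?thesis unfolding C_def .
qed

text \<open>The matrix with these rows has Gram matrix \<^const>\<open>hessian\<close>.\<close>

definition stacked_row :: "real mat \<Rightarrow> real \<Rightarrow> nat \<Rightarrow> real vec" where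
  "stacked_row X lam d =
    (if d < dim_row X then row X d else sqrt lam \<cdot>\<^sub>v unit_vec (dim_col X) (d - dim_row X))"

text \<open>The form of the Hessian at \<open>y\<close> is the sum of these squares over all
  \<open>d\<close>, hence at least each of them.\<close>

lemma stacked_row_square_le:
  assumes X: "X \<in> carrier_mat m N" and "0 < lam" and "d < m + N" and y: "y \<in> carrier_vec N"
  shows "(stacked_row X lam d \<bullet> y)\<^sup>2 \<le> y \<bullet> (hessian X lam *\<^sub>v y)"
proof (cases "d < m")
  case True
  then have "(stacked_row X lam d \<bullet> y)\<^sup>2 = ((X *\<^sub>v y) $ d)\<^sup>2"
    using X by (simp add: stacked_row_def)
  also have "\<dots> \<le> (X *\<^sub>v y) \<bullet> (X *\<^sub>v y)"
    using X True by (intro square_nth_le_scalar_prod_self) simp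
  finally show ?thesis
    using hessian_form[OF X y, of lam] scalar_prod_self_nonneg[of y] \<open>0 < lam\<close>
    by (simp add: add_increasing2)
next
  case False
  then have "(stacked_row X lam d \<bullet> y)\<^sup>2 = lam * (y $ (d - m))\<^sup>2"
    using X y \<open>d < m + N\<close> \<open>0 < lam\<close> by (simp add: stacked_row_def power_mult_distrib)
  also have "\<dots> \<le> lam * (y \<bullet> y)"
    using y False \<open>0 < lam\<close> \<open>d < m + N\<close> by (intro mult_left_mono square_nth_le_scalar_prod_self) auto
  finally show ?thesis
    using hessian_form[OF X y, of lam] scalar_prod_self_nonneg[of "X *\<^sub>v y"] by simp
qed

text \<open>Each column in \<open>K\<close> undergoes \<open>m + N\<close> linear tests, one per
  stacked row, each failing with probability at most \<open>2 * exp (- 4 * pi * \<kappa>)\<close>.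
  The set \<open>K\<close> is a single column or all of them, and \<open>E\<close> is any event
  implied by passing the tests.\<close>

lemma optq_union_bound:
  assumes X: "X \<in> carrier_mat m N" and W: "W \<in> carrier_mat N N'"
    and "0 < m" "0 < N" "0 < lam" "0 < \<delta>" "0 \<le> \<kappa>" and K: "K \<subseteq> {..<N'}"
    and E: "\<And>Q. Q \<in> carrier_mat N N' \<Longrightarrow> (\<And>k d. k \<in> K \<Longrightarrow> d < m + N \<Longrightarrow>
      \<bar>\<Sum>i<N. stacked_row X lam d $ i * (Q $$ (i, k) - W $$ (i, k))\<bar>
        \<le> \<delta> * sqrt (2 * pi * \<kappa>) * C_inf X lam) \<Longrightarrow> Q \<in> E"
  shows "1 - 2 * real (card K) * (real m + real N) * exp (- 4 * pi * \<kappa>)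
    \<le> measure_pmf.prob (optq \<delta> (hessian X lam) W) E"
proof -
  let ?H = "hessian X lam"
  define \<tau> where "\<tau> = \<delta> * sqrt (2 * pi * \<kappa>) * C_inf X lam"
  define P where "P = Pi_pmf {..<N'} (0\<^sub>v N) (\<lambda>k. optq_vec \<delta> ?H (col W k))"
  define g where "g f = mat N N' (\<lambda>(i, k). (f k :: real vec) $ i)" for f
  define bad where "bad k d = {q. \<tau> < \<bar>\<Sum>i<N. stacked_row X lam d $ i * (q $ i - col W k $ i)\<bar>}" for k d
  let ?I = "K \<times> {..<m + N}"
  have finK: "finite K" using K by (rule finite_subset) simp
  have optq: "optq \<delta> ?H W = map_pmf g P"
    unfolding optq_def g_def P_def using W by simp
  have tail: "measure_pmf.prob P {f. f k \<in> bad k d} \<le> 2 * exp (- 4 * pi * \<kappa>)"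
    if "k \<in> K" "d < m + N" for k d
  proof -
    have k: "k < N'" using that K by auto
    have "measure_pmf.prob P {f. f k \<in> bad k d} = measure_pmf.prob (map_pmf (\<lambda>f. f k) P) (bad k d)"
      by (simp add: vimage_def)
    \<comment> \<open>The marginal of the product distribution at \<open>k\<close> is the law of one
      OPTQ run.\<close>
    also have "map_pmf (\<lambda>f. f k) P = optq_vec \<delta> ?H (col W k)"
      unfolding P_def using k by (subst Pi_pmf_component) auto
    also have "measure_pmf.prob (optq_vec \<delta> ?H (col W k)) (bad k d) \<le> 2 * exp (- 4 * pi * \<kappa>)"
      unfolding bad_def \<tau>_def
      using X W k \<open>d < m + N\<close> assms(3-7)
      by (intro optq_vec_tail stacked_row_square_le) (auto simp: stacked_row_def)
    finally show ?thesis .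
  qed
  have "measure_pmf.prob P (\<Union>(k, d)\<in>?I. {f. f k \<in> bad k d})
      \<le> (\<Sum>(k, d)\<in>?I. measure_pmf.prob P {f. f k \<in> bad k d})"
    using finK measure_pmf.finite_measure_subadditive_finite[of ?I "\<lambda>(k, d). {f. f k \<in> bad k d}" P]
    by (simp add: case_prod_beta)
  also have "\<dots> \<le> (\<Sum>(k, d)\<in>?I. 2 * exp (- 4 * pi * \<kappa>))"
    using tail by (intro sum_mono) auto
  also have "\<dots> = 2 * real (card K) * (real m + real N) * exp (- 4 * pi * \<kappa>)"
    by (simp add: card_cartesian_product algebra_simps)
  finally have "1 - 2 * real (card K) * (real m + real N) * exp (- 4 * pi * \<kappa>)
      \<le> 1 - measure_pmf.prob P (\<Union>(k, d)\<in>?I. {f. f k \<in> bad k d})" by simp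
  also have "\<dots> = measure_pmf.prob P (- (\<Union>(k, d)\<in>?I. {f. f k \<in> bad k d}))"
    by (subst measure_pmf.prob_compl[symmetric]) (auto simp: Compl_eq_Diff_UNIV)
  also have "\<dots> \<le> measure_pmf.prob P (g -` E)"
  proof (intro measure_pmf.finite_measure_mono subsetI vimageI2 E)
    fix f k d assume "f \<in> - (\<Union>(k, d)\<in>?I. {f. f k \<in> bad k d})" "k \<in> K" "d < m + N"
    then have "\<bar>\<Sum>i<N. stacked_row X lam d $ i * (f k $ i - col W k $ i)\<bar> \<le> \<tau>"
      by (auto simp: bad_def not_less)
    also have "(\<Sum>i<N. stacked_row X lam d $ i * (f k $ i - col W k $ i))
        = (\<Sum>i<N. stacked_row X lam d $ i * (g f $$ (i, k) - W $$ (i, k)))"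
      using W K \<open>k \<in> K\<close> by (intro sum.cong) (auto simp: g_def)
    finally show "\<bar>\<Sum>i<N. stacked_row X lam d $ i * (g f $$ (i, k) - W $$ (i, k))\<bar>
        \<le> \<delta> * sqrt (2 * pi * \<kappa>) * C_inf X lam" unfolding \<tau>_def .
  qed (auto simp: g_def)
  finally show ?thesis unfolding optq by simp
qed

text \<open>Up to sign, row \<open>i < m\<close> reads off a coordinate of the output error, and row
  \<open>m + j\<close> reads off \<open>sqrt lam\<close> times coordinate \<open>j\<close> of the
  weight error.\<close>

lemma stacked_row_bounds:
  assumes X: "X \<in> carrier_mat m N" and W: "W \<in> carrier_mat N N'" and Q: "Q \<in> carrier_mat N N'"
    and "0 < lam" "k < N'"
    and le: "\<And>d. d < m + N \<Longrightarrow> \<bar>\<Sum>i<N. stacked_row X lam d $ i * (Q $$ (i, k) - W $$ (i, k))\<bar> \<le> \<tau>"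
  shows "i < m \<Longrightarrow> \<bar>(X *\<^sub>v col W k - X *\<^sub>v col Q k) $ i\<bar> \<le> \<tau>"
    and "j < N \<Longrightarrow> \<bar>(col W k - col Q k) $ j\<bar> \<le> \<tau> / sqrt lam"
proof -
  assume i: "i < m"
  have "(X *\<^sub>v col W k - X *\<^sub>v col Q k) $ i
      = - (\<Sum>j<N. stacked_row X lam i $ j * (Q $$ (j, k) - W $$ (j, k)))"
    using X W Q i \<open>k < N'\<close>
    by (simp add: stacked_row_def scalar_prod_sum sum_subtractf right_diff_distrib)
  then show "\<bar>(X *\<^sub>v col W k - X *\<^sub>v col Q k) $ i\<bar> \<le> \<tau>" using le[of i] i by simp
next
  assume j: "j < N"
  have "(\<Sum>i<N. stacked_row X lam (m + j) $ i * (Q $$ (i, k) - W $$ (i, k)))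
      = (\<Sum>i<N. if i = j then sqrt lam * (Q $$ (i, k) - W $$ (i, k)) else 0)"
    using X j by (intro sum.cong) (auto simp: stacked_row_def)
  also have "\<dots> = sqrt lam * (Q $$ (j, k) - W $$ (j, k))" using j by simp
  finally have "sqrt lam * \<bar>Q $$ (j, k) - W $$ (j, k)\<bar> \<le> \<tau>"
    using le[of "m + j"] j \<open>0 < lam\<close> by (simp add: abs_mult)
  then show "\<bar>(col W k - col Q k) $ j\<bar> \<le> \<tau> / sqrt lam"
    using W Q j \<open>k < N'\<close> \<open>0 < lam\<close> by (simp add: pos_le_divide_eq mult.commute abs_minus_commute)
qed

section \<open>Norms, the failure probability and the final assembly\<close>

lemma linf_norm_le:
  assumes "0 < dim_vec v" "\<And>i. i < dim_vec v \<Longrightarrow> \<bar>v $ i\<bar> \<le> c"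
  shows "linf_norm v \<le> c"
  unfolding linf_norm_def using assms by (subst Max_le_iff) auto

lemma max_abs_entry_le:
  assumes "0 < dim_row A" "0 < dim_col A"
    and "\<And>i j. i < dim_row A \<Longrightarrow> j < dim_col A \<Longrightarrow> \<bar>A $$ (i, j)\<bar> \<le> c"
  shows "max_abs_entry A \<le> c"
  unfolding max_abs_entry_def using assms by (subst Max_le_iff) (auto simp: lessThan_empty_iff)

text \<open>The target is nontrivial only if \<open>sqrt 2 * M * n < y\<close>, where \<open>y \<ge> 2\<close>; there the
  exponent \<open>4 \<pi>\<close> leaves room to absorb the constant.\<close>

lemma failure_bound_le:
  fixes y M n :: real
  assumes "2 \<le> M" "1 \<le> n" "0 \<le> \<kappa>" "y = exp \<kappa>"
    and prob: "1 - 2 * n * M * exp (- 4 * pi * \<kappa>) \<le> b" and "0 \<le> b"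
  shows "1 - sqrt 2 * M * n / y \<le> b"
proof (cases "y \<le> sqrt 2 * M * n")
  case True
  then have "1 \<le> sqrt 2 * M * n / y" using assms(4) by simp
  then show ?thesis using \<open>0 \<le> b\<close> by simp
next
  case False
  have "sqrt 2 * 2 * 1 \<le> sqrt 2 * M * n"
    using assms(1,2) by (intro mult_mono) auto
  then have "sqrt 2 * 2 \<le> y" using False by linarith
  then have y: "sqrt 2 \<le> y" "0 < y" using real_sqrt_ge_zero[of 2] assms(4) by (linarith, simp)
  have "exp (- 4 * pi * \<kappa>) \<le> exp (- 2 * \<kappa>)"
    using \<open>0 \<le> \<kappa>\<close> pi_gt3 by (simp add: mult_right_mono)
  also have "\<dots> = 1 / y * (1 / y)"
    unfolding assms(4) by (simp add: exp_minus field_simps flip: exp_add)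
  \<comment> \<open>Giving up one factor \<open>1 / y\<close> for \<open>1 / sqrt 2\<close> lowers
    the constant 2 of the union bound to \<open>sqrt 2\<close>.\<close>
  also have "\<dots> \<le> 1 / y * (1 / sqrt 2)"
    using y by (intro mult_left_mono divide_left_mono) auto
  finally have "2 * exp (- 4 * pi * \<kappa>) \<le> 2 * (1 / y * (1 / sqrt 2))"
    by (rule mult_left_mono) simp
  also have "\<dots> = 2 / sqrt 2 / y" by (simp add: mult.commute)
  also have "\<dots> = sqrt 2 / y" by (simp only: real_div_sqrt)
  finally have "2 * exp (- 4 * pi * \<kappa>) \<le> sqrt 2 / y" .
  then have "(n * M) * (2 * exp (- 4 * pi * \<kappa>)) \<le> (n * M) * (sqrt 2 / y)"
    using assms by (intro mult_left_mono) auto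
  then show ?thesis using prob by (simp add: mult_ac)
qed

theorem theorem4p6:
  fixes X W :: "real mat" and m N N' :: nat and lam \<delta> p p' :: real
  assumes "0 < m" and "0 < N" and "0 < N'"
    and "X \<in> carrier_mat m N" and "W \<in> carrier_mat N N'"
    and "0 < lam" and "0 < \<delta>" and "0 < p" and "0 < p'"
  shows "(\<forall>k<N'.
      measure_pmf.prob (optq \<delta> (hessian X lam) W)
        {Q. linf_norm (X *\<^sub>v col W k - X *\<^sub>v col Q k)
              \<le> \<delta> * sqrt (2 * pi * p * ln (real N)) * C_inf X lam \<and>
            linf_norm (col W k - col Q k)
              \<le> \<delta> * sqrt (2 * pi * p * ln (real N)) * (C_inf X lam / sqrt lam)}
      \<ge> 1 - sqrt 2 * (real m + real N) / (real N powr p)) \<and>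
    measure_pmf.prob (optq \<delta> (hessian X lam) W)
        {Q. max_abs_entry (X * W - X * Q)
              \<le> \<delta> * sqrt (2 * pi * (p * ln (real N) + p' * ln (real N'))) * C_inf X lam \<and>
            max_abs_entry (W - Q)
              \<le> \<delta> * sqrt (2 * pi * (p * ln (real N) + p' * ln (real N')))
                  * (C_inf X lam / sqrt lam)}
      \<ge> 1 - sqrt 2 * (real m + real N) / (real N powr p * real N' powr (p' - 1))"
proof (intro conjI allI impI)
  fix k assume k: "k < N'"
  let ?\<kappa> = "p * ln (real N)"
  let ?E = "{Q. linf_norm (X *\<^sub>v col W k - X *\<^sub>v col Q k)
      \<le> \<delta> * sqrt (2 * pi * p * ln (real N)) * C_inf X lam \<and>
    linf_norm (col W k - col Q k)
      \<le> \<delta> * sqrt (2 * pi * p * ln (real N)) * (C_inf X lam / sqrt lam)}"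
  have \<kappa>: "0 \<le> ?\<kappa>" using assms by simp
  have "1 - 2 * real (card {k}) * (real m + real N) * exp (- 4 * pi * ?\<kappa>)
      \<le> measure_pmf.prob (optq \<delta> (hessian X lam) W) ?E"
  proof (rule optq_union_bound[OF assms(4,5,1,2,6,7) \<kappa>])
    fix Q assume Q: "Q \<in> carrier_mat N N'"
      and le: "\<And>k' d. k' \<in> {k} \<Longrightarrow> d < m + N \<Longrightarrow>
        \<bar>\<Sum>i<N. stacked_row X lam d $ i * (Q $$ (i, k') - W $$ (i, k'))\<bar>
          \<le> \<delta> * sqrt (2 * pi * ?\<kappa>) * C_inf X lam"
    note b = stacked_row_bounds[OF assms(4,5) Q assms(6) k le[OF singletonI]]
    have "linf_norm (X *\<^sub>v col W k - X *\<^sub>v col Q k) \<le> \<delta> * sqrt (2 * pi * ?\<kappa>) * C_inf X lam"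
      using b(1) assms by (intro linf_norm_le) auto
    moreover have "linf_norm (col W k - col Q k) \<le> \<delta> * sqrt (2 * pi * ?\<kappa>) * C_inf X lam / sqrt lam"
      using b(2) assms Q by (intro linf_norm_le) auto
    ultimately show "Q \<in> ?E" by (simp add: mult.assoc)
  qed (use k in auto)
  \<comment> \<open>Here \<open>n\<close> is 1 and \<open>y\<close> is \<open>real N powr p\<close>,
    the exponential of \<open>p * ln (real N)\<close>.\<close>
  from failure_bound_le[OF _ _ \<kappa> _ this]
  show "1 - sqrt 2 * (real m + real N) / (real N powr p)
      \<le> measure_pmf.prob (optq \<delta> (hessian X lam) W) ?E"
    using assms by (simp add: powr_def)
next
  let ?\<kappa> = "p * ln (real N) + p' * ln (real N')"
  let ?E = "{Q. max_abs_entry (X * W - X * Q)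
      \<le> \<delta> * sqrt (2 * pi * (p * ln (real N) + p' * ln (real N'))) * C_inf X lam \<and>
    max_abs_entry (W - Q)
      \<le> \<delta> * sqrt (2 * pi * (p * ln (real N) + p' * ln (real N'))) * (C_inf X lam / sqrt lam)}"
  have \<kappa>: "0 \<le> ?\<kappa>" using assms by simp
  have "1 - 2 * real (card {..<N'}) * (real m + real N) * exp (- 4 * pi * ?\<kappa>)
      \<le> measure_pmf.prob (optq \<delta> (hessian X lam) W) ?E"
  proof (rule optq_union_bound[OF assms(4,5,1,2,6,7) \<kappa>])
    fix Q assume Q: "Q \<in> carrier_mat N N'"
      and le: "\<And>k d. k \<in> {..<N'} \<Longrightarrow> d < m + N \<Longrightarrow>
        \<bar>\<Sum>i<N. stacked_row X lam d $ i * (Q $$ (i, k) - W $$ (i, k))\<bar>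
          \<le> \<delta> * sqrt (2 * pi * ?\<kappa>) * C_inf X lam"
    note b = stacked_row_bounds[OF assms(4,5) Q assms(6) _ le[OF lessThan_iff[THEN iffD2]]]
    have "max_abs_entry (X * W - X * Q) \<le> \<delta> * sqrt (2 * pi * ?\<kappa>) * C_inf X lam"
    proof (rule max_abs_entry_le)
      fix i j assume "i < dim_row (X * W - X * Q)" "j < dim_col (X * W - X * Q)"
      then show "\<bar>(X * W - X * Q) $$ (i, j)\<bar> \<le> \<delta> * sqrt (2 * pi * ?\<kappa>) * C_inf X lam"
        using b(1)[of j i] assms Q by simp
    qed (use assms Q in auto)
    moreover have "max_abs_entry (W - Q) \<le> \<delta> * sqrt (2 * pi * ?\<kappa>) * C_inf X lam / sqrt lam"
    proof (rule max_abs_entry_le)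
      fix i j assume "i < dim_row (W - Q)" "j < dim_col (W - Q)"
      then show "\<bar>(W - Q) $$ (i, j)\<bar> \<le> \<delta> * sqrt (2 * pi * ?\<kappa>) * C_inf X lam / sqrt lam"
        using b(2)[of j i] assms Q by simp
    qed (use assms Q in auto)
    ultimately show "Q \<in> ?E" by simp
  qed simp
  from failure_bound_le[OF _ _ \<kappa> refl this]
  have "1 - sqrt 2 * (real m + real N) * real N' / exp ?\<kappa>
      \<le> measure_pmf.prob (optq \<delta> (hessian X lam) W) ?E"
    using assms by simp
  also have "exp ?\<kappa> = real N powr p * real N' powr (p' - 1 + 1)"
    using assms by (simp add: powr_def exp_add)
  \<comment> \<open>The factor \<open>real N'\<close> split off here cancels the number of columns
    from the union bound, which leaves the exponent \<open>p' - 1\<close>.\<close>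
  also have "\<dots> = real N powr p * (real N' powr (p' - 1) * real N')"
    using assms by (subst powr_add) simp
  finally show "1 - sqrt 2 * (real m + real N) / (real N powr p * real N' powr (p' - 1))
      \<le> measure_pmf.prob (optq \<delta> (hessian X lam) W) ?E"
    using assms by (simp add: mult.assoc[symmetric])
qed

end
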